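(* There is an algorithm that, given as input any finite simple undirected graph $G=(V,E)$ of order $n$, outputs an MLS cover of $G$ in time polynomial in $n$; moreover the algorithm uses $O(n^4)$ evaluations of the cut-rank function of $G$.
   Context: For a finite simple undirected graph $G=(V,E)$ and $D\subseteq V$, the odd neighborhood of $D$ is $Odd_G(D)=\{v\in V : |N_G(v)\cap D| \equiv 1 \pmod 2\}$, where $N_G(v)$ is the set of neighbors of $v$. A local set of $G$ is a non-empty subset $L\subseteq V$ of the form $L=D\cup Odd_G(D)$ for some $D\subseteq V$. A minimal local set is a local set that is minimal by inclusion among local sets. A family $\mathcal L\subseteq 2^V$ is an MLS cover of $G$ if every $L\in\mathcal L$ is a minimal local set of $G$ and every $u\in V$ belongs to some $L\in\mathcal L$. The cut-rank function $\mathrm{cutrk}:2^V\to\mathbb N$ of $G$ maps $A\subseteq V$ to the rank over $\mathbb F_2$ of the matrix $\Gamma_A$ with rows indexed by $A$, columns indexed by $V\setminus A$, and entry $1$ at $(a,b)$ if $(a,b)\in E$ and $0$ otherwise. One evaluation of the cut-rank function means computing $\mathrm{cutrk}(A)$ for one set $A\subseteq V$. *)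

theory Defs
  imports
    "Graph_Theory.Pair_Digraph"
    "Jordan_Normal_Form.DL_Rank"
    "HOL-Library.Z2"
    "HOL-Library.Landau_Symbols"
begin

section \<open>Local sets, minimal local sets, MLS covers, cut-rank\<close>

text \<open>
  A finite simple undirected graph is a \<^locale>\<open>pair_graph\<close>: finitely many vertices, a symmetric
  irreflexive arc relation, an edge between \<open>u\<close> and \<open>v\<close> being represented by both \<open>(u, v)\<close>
  and \<open>(v, u)\<close>.
\<close>

definition neighborhood :: "'a pair_pre_digraph \<Rightarrow> 'a \<Rightarrow> 'a set" where
  "neighborhood G v = {u \<in> pverts G. (v, u) \<in> parcs G}"

definition Odd :: "'a pair_pre_digraph \<Rightarrow> 'a set \<Rightarrow> 'a set" where
  "Odd G D = {v \<in> pverts G. odd (card (neighborhood G v \<inter> D))}"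

definition local_set :: "'a pair_pre_digraph \<Rightarrow> 'a set \<Rightarrow> bool" where
  "local_set G L \<longleftrightarrow> L \<noteq> {} \<and> (\<exists>D \<subseteq> pverts G. L = D \<union> Odd G D)"

definition minimal_local_set :: "'a pair_pre_digraph \<Rightarrow> 'a set \<Rightarrow> bool" where
  "minimal_local_set G L \<longleftrightarrow> local_set G L \<and> (\<forall>L'. local_set G L' \<longrightarrow> \<not> L' \<subset> L)"

definition MLS_cover :: "'a pair_pre_digraph \<Rightarrow> 'a set set \<Rightarrow> bool" where
  "MLS_cover G \<L> \<longleftrightarrow>
     (\<forall>L \<in> \<L>. minimal_local_set G L) \<and> (\<forall>u \<in> pverts G. \<exists>L \<in> \<L>. u \<in> L)"

text \<open>
  The linear order on the vertices only serves to number the rows and the columns of the cut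
  matrix; the rank does not depend on it.
\<close>

definition cut_matrix :: "'a::linorder pair_pre_digraph \<Rightarrow> 'a set \<Rightarrow> bit mat" where
  "cut_matrix G A =
     (let rs = sorted_list_of_set A; cs = sorted_list_of_set (pverts G - A)
      in mat (length rs) (length cs) (\<lambda>(i, j). if (rs ! i, cs ! j) \<in> parcs G then 1 else 0))"

definition cutrk :: "'a::linorder pair_pre_digraph \<Rightarrow> 'a set \<Rightarrow> nat" where
  "cutrk G A = vec_space.rank (dim_row (cut_matrix G A)) (cut_matrix G A)"

section \<open>Random access machine programs\<close>

text \<open>
  Structured programs for a random access machine over the natural numbers, with registers and
  two-dimensional arrays, both numbered. The arithmetic consists of addition and truncated
  subtraction only: a number obtained in \<open>t\<close> steps has \<open>O(t)\<close> more bits than the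
  input numbers, so that up to polynomials unit-cost time agrees with Turing machine time
  (with unit-cost multiplication it would not).
\<close>

datatype exp = Const nat | Reg nat | Arr nat exp exp | Plus exp exp | Minus exp exp

record state =
  reg :: "nat \<Rightarrow> nat"
  arr :: "nat \<Rightarrow> nat \<Rightarrow> nat \<Rightarrow> nat"

primrec val :: "state \<Rightarrow> exp \<Rightarrow> nat" where
  "val s (Const k) = k"
| "val s (Reg x) = reg s x"
| "val s (Arr a d e) = arr s a (val s d) (val s e)"
| "val s (Plus d e) = val s d + val s e"
| "val s (Minus d e) = val s d - val s e"

primrec cost :: "exp \<Rightarrow> nat" where
  "cost (Const k) = 1"
| "cost (Reg x) = 1"
| "cost (Arr a d e) = 1 + cost d + cost e"
| "cost (Plus d e) = 1 + cost d + cost e"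
| "cost (Minus d e) = 1 + cost d + cost e"

definition set_reg :: "nat \<Rightarrow> nat \<Rightarrow> state \<Rightarrow> state" where
  "set_reg x k s = s\<lparr>reg := (reg s)(x := k)\<rparr>"

definition set_arr :: "nat \<Rightarrow> nat \<Rightarrow> nat \<Rightarrow> nat \<Rightarrow> state \<Rightarrow> state" where
  "set_arr a i j k s = s\<lparr>arr := (arr s)(a := (arr s a)(i := (arr s a i)(j := k)))\<rparr>"

text \<open>
  The type parameter \<open>'q\<close> is the type of the query instructions, by which a program accesses
  data outside of its own memory. Tests in \<open>If\<close> and \<open>While\<close> read nonzero as true.
\<close>

datatype 'q com =
    Skip
  | Assign nat exp
  | Store nat exp exp exp
  | Seq "'q com" "'q com"
  | If exp "'q com" "'q com"
  | While exp "'q com"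
  | Query 'q

text \<open>
  \<open>exec ask c s t q s'\<close>: started in \<open>s\<close>, the program \<open>c\<close> terminates in \<open>s'\<close> after \<open>t\<close> time
  units and \<open>q\<close> queries. The effect and the duration of a query are given by
  \<open>ask\<close>.
\<close>

inductive exec ::
  "('q \<Rightarrow> state \<Rightarrow> nat \<Rightarrow> state \<Rightarrow> bool) \<Rightarrow> 'q com \<Rightarrow> state \<Rightarrow> nat \<Rightarrow> nat \<Rightarrow> state \<Rightarrow> bool"
  for ask where
  Skip: "exec ask Skip s 1 0 s"
| Assign: "exec ask (Assign x e) s (1 + cost e) 0 (set_reg x (val s e) s)"
| Store: "exec ask (Store a d e f) s (1 + cost d + cost e + cost f) 0
            (set_arr a (val s d) (val s e) (val s f) s)"
| Seq: "exec ask c s t q s' \<Longrightarrow> exec ask c' s' t' q' s'' \<Longrightarrow>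
        exec ask (Seq c c') s (t + t') (q + q') s''"
| IfTrue: "val s e \<noteq> 0 \<Longrightarrow> exec ask c s t q s' \<Longrightarrow>
           exec ask (If e c c') s (1 + cost e + t) q s'"
| IfFalse: "val s e = 0 \<Longrightarrow> exec ask c' s t q s' \<Longrightarrow>
            exec ask (If e c c') s (1 + cost e + t) q s'"
| WhileFalse: "val s e = 0 \<Longrightarrow> exec ask (While e c) s (1 + cost e) 0 s"
| WhileTrue: "val s e \<noteq> 0 \<Longrightarrow> exec ask c s t q s' \<Longrightarrow> exec ask (While e c) s' t' q' s'' \<Longrightarrow>
              exec ask (While e c) s (1 + cost e + t + t') (q + q') s''"
| Query: "ask i s t s' \<Longrightarrow> exec ask (Query i) s t 1 s'"

lemma exec_deterministic:
  assumes ask: "\<And>i s t s' u s''. ask i s t s' \<Longrightarrow> ask i s u s'' \<Longrightarrow> t = u \<and> s' = s''"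
  shows "exec ask c s t q s' \<Longrightarrow> exec ask c s t' q' s'' \<Longrightarrow> t = t' \<and> q = q' \<and> s' = s''"
proof (induction arbitrary: t' q' s'' rule: exec.induct)
  case (Seq c s t q s' c' t2 q2 s2)
  from Seq.prems obtain u p r u2 p2 where
    "exec ask c s u p r" "exec ask c' r u2 p2 s''" "t' = u + u2" "q' = p + p2"
    by (cases rule: exec.cases) auto
  with Seq.IH(1)[of u p r] Seq.IH(2)[of u2 p2 s''] show ?case by simp
next
  case (WhileTrue s e c t q s' t2 q2 s2)
  from WhileTrue.prems WhileTrue.hyps(1) obtain u p r u2 p2 where
    "exec ask c s u p r" "exec ask (While e c) r u2 p2 s''"
    "t' = 1 + cost e + u + u2" "q' = p + p2"
    by (cases rule: exec.cases) auto
  with WhileTrue.IH(1)[of u p r] WhileTrue.IH(2)[of u2 p2 s''] show ?case by simp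
next
  case (IfTrue s e c t q s' c')
  from IfTrue.prems IfTrue.hyps(1) obtain u where
    "exec ask c s u q' s''" "t' = 1 + cost e + u"
    by (cases rule: exec.cases) auto
  with IfTrue.IH[of u q' s''] show ?case by simp
next
  case (IfFalse s e c' t q s' c)
  from IfFalse.prems IfFalse.hyps(1) obtain u where
    "exec ask c' s u q' s''" "t' = 1 + cost e + u"
    by (cases rule: exec.cases) auto
  with IfFalse.IH[of u q' s''] show ?case by simp
next
  case (Query i s t s')
  from Query.prems have "ask i s t' s''" "q' = 1"
    by (cases rule: exec.cases; simp)+
  with ask[OF Query.hyps] show ?case by simp
next
  case (Skip s)
  from Skip.prems show ?case by (cases rule: exec.cases) auto
next
  case (Assign x e s)
  from Assign.prems show ?case by (cases rule: exec.cases) auto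
next
  case (Store a d e f s)
  from Store.prems show ?case by (cases rule: exec.cases) auto
next
  case (WhileFalse s e c)
  from WhileFalse.prems WhileFalse.hyps show ?case by (cases rule: exec.cases) auto
qed

section \<open>Algorithms on graphs using evaluations of the cut-rank function\<close>

text \<open>
  The input graph has the vertices \<open>0, \<dots>, n - 1\<close>. An algorithm consists of a subroutine and a
  main program. The subroutine evaluates the cut-rank function; it accesses the graph by
  adjacency tests.
\<close>

datatype adj_test = Adj nat exp exp

fun ask_adj :: "nat pair_pre_digraph \<Rightarrow> adj_test \<Rightarrow> state \<Rightarrow> nat \<Rightarrow> state \<Rightarrow> bool" where
  "ask_adj G (Adj x d e) s t s' \<longleftrightarrow>
     t = 1 + cost d + cost e \<and>
     s' = set_reg x (if (val s d, val s e) \<in> parcs G then 1 else 0) s"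

text \<open>
  The subroutine starts in a memory of its own, with the order of the graph in register 0 and the
  characteristic vector of a set of vertices in row 0 of array 0. It returns register 0.
\<close>

definition sub_start :: "nat \<Rightarrow> nat set \<Rightarrow> state" where
  "sub_start n A =
     \<lparr>reg = (\<lambda>x. if x = 0 then n else 0),
      arr = (\<lambda>a i j. if a = 0 \<and> i = 0 \<and> j < n \<and> j \<in> A then 1 else 0)\<rparr>"

definition sub_run ::
  "adj_test com \<Rightarrow> nat pair_pre_digraph \<Rightarrow> nat set \<Rightarrow> nat \<Rightarrow> nat \<Rightarrow> bool" where
  "sub_run sub G A t k \<longleftrightarrow>
     (\<exists>q s. exec (ask_adj G) sub (sub_start (card (pverts G)) A) t q s \<and> k = reg s 0)"

definition computes_cutrk :: "adj_test com \<Rightarrow> nat pair_pre_digraph \<Rightarrow> bool" where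
  "computes_cutrk sub G \<longleftrightarrow> (\<forall>A \<subseteq> pverts G. \<exists>t. sub_run sub G A t (cutrk G A))"

text \<open>
  The main program accesses the graph by calls of the subroutine only. Without this restriction a
  bound on the number of calls would be void, since a program with access to the edges could
  compute the cut-rank by itself. The instruction \<open>Eval x a e\<close> passes row \<open>e\<close> of array \<open>a\<close> to
  the subroutine and puts the result into register \<open>x\<close>. It takes \<open>n\<close> time units to pass the
  row, and the running time of the subroutine.
\<close>

datatype cutrk_call = Eval nat nat exp

definition row_set :: "nat \<Rightarrow> state \<Rightarrow> nat \<Rightarrow> nat \<Rightarrow> nat set" where
  "row_set n s a i = {j. j < n \<and> arr s a i j \<noteq> 0}"

fun ask_sub ::
  "adj_test com \<Rightarrow> nat pair_pre_digraph \<Rightarrow> cutrk_call \<Rightarrow> state \<Rightarrow> nat \<Rightarrow> state \<Rightarrow> bool" where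
  "ask_sub sub G (Eval x a e) s t s' \<longleftrightarrow>
     (\<exists>u k. sub_run sub G (row_set (card (pverts G)) s a (val s e)) u k \<and>
            t = 1 + cost e + card (pverts G) + u \<and> s' = set_reg x k s)"

definition main_start :: "nat \<Rightarrow> state" where
  "main_start n = \<lparr>reg = (\<lambda>x. if x = 0 then n else 0), arr = (\<lambda>a i j. 0)\<rparr>"

text \<open>
  The output is a list of sets of vertices: its length is in register 0, the characteristic vectors
  of its members are the rows of array 0.
\<close>

definition output_family :: "nat \<Rightarrow> state \<Rightarrow> nat set set" where
  "output_family n s = row_set n s 0 ` {..<reg s 0}"

text \<open>
  \<open>algorithm_run main sub G t q \<L>\<close>: on input \<open>G\<close> the algorithm outputs \<open>\<L>\<close> after \<open>t\<close> time units,
  including those spent in the subroutine, and \<open>q\<close> calls of the subroutine.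
\<close>

definition algorithm_run ::
  "cutrk_call com \<Rightarrow> adj_test com \<Rightarrow> nat pair_pre_digraph \<Rightarrow> nat \<Rightarrow> nat \<Rightarrow> nat set set \<Rightarrow> bool"
where
  "algorithm_run main sub G t q \<L> \<longleftrightarrow>
     (\<exists>s. exec (ask_sub sub G) main (main_start (card (pverts G))) t q s \<and>
          \<L> = output_family (card (pverts G)) s)"

lemma sub_run_deterministic:
  assumes "sub_run sub G A t k" "sub_run sub G A t' k'"
  shows "t = t' \<and> k = k'"
proof -
  have ask: "t = u \<and> s' = s''" if "ask_adj G i s t s'" "ask_adj G i s u s''" for i s t s' u s''
    using that by (cases i) simp
  from assms obtain q s q' s' where
    "exec (ask_adj G) sub (sub_start (card (pverts G)) A) t q s" "k = reg s 0"
    "exec (ask_adj G) sub (sub_start (card (pverts G)) A) t' q' s'" "k' = reg s' 0"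
    unfolding sub_run_def by blast
  moreover from this(1,3) have "t = t' \<and> q = q' \<and> s = s'"
    by (rule exec_deterministic[rotated]) (use ask in blast)
  ultimately show ?thesis by simp
qed

lemma algorithm_run_deterministic:
  assumes "algorithm_run main sub G t q \<L>" "algorithm_run main sub G t' q' \<L>'"
  shows "t = t' \<and> q = q' \<and> \<L> = \<L>'"
proof -
  have ask: "t = u \<and> s' = s''" if "ask_sub sub G i s t s'" "ask_sub sub G i s u s''"
    for i s t s' u s''
  proof (cases i)
    case (Eval x a e)
    from that obtain v k v' k' where
      "sub_run sub G (row_set (card (pverts G)) s a (val s e)) v k"
      "t = 1 + cost e + card (pverts G) + v" "s' = set_reg x k s"
      "sub_run sub G (row_set (card (pverts G)) s a (val s e)) v' k'"
      "u = 1 + cost e + card (pverts G) + v'" "s'' = set_reg x k' s"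
      unfolding Eval ask_sub.simps by blast
    with sub_run_deterministic show ?thesis by blast
  qed
  from assms obtain s s' where
    "exec (ask_sub sub G) main (main_start (card (pverts G))) t q s"
    "\<L> = output_family (card (pverts G)) s"
    "exec (ask_sub sub G) main (main_start (card (pverts G))) t' q' s'"
    "\<L>' = output_family (card (pverts G)) s'"
    unfolding algorithm_run_def by blast
  moreover from this(1,3) have "t = t' \<and> q = q' \<and> s = s'"
    by (rule exec_deterministic[rotated]) (use ask in blast)
  ultimately show ?thesis by simp
qed

end

(*
  A set A of vertices contains a local set iff its cut-rank is less than |A|, so the sets of full
  cut-rank are closed under subsets, and the minimal local sets are the minimal sets that do not
  have full cut-rank. Let Q be a maximal set of full cut-rank avoiding a vertex a. Then Q + a does not
  have full cut-rank: otherwise there are vertex sets X, Z, both outside Q, such that, with odd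
  neighborhoods included, they meet Q + a at most in a and |X \<inter> Odd Z| + |Z \<inter> Odd X| receives exactly one
  unit from a; every other vertex c contributes an even number, because Q + c contains a local set D \<union> Odd D
  with c in it, and D is orthogonal to both X and Z. But the sum is even, as both terms count the
  edges between X and Z modulo 2. Hence any minimal set without full cut-rank inside Q + a is a
  minimal local set containing a. Both Q and this minimal set are found greedily, with one
  evaluation of the cut-rank per vertex. The cut-rank itself is computed by Gaussian elimination.
*)

theory Submission
  imports Defs
begin

section \<open>Cut-rank and local sets\<close>

lemma sum_of_bool_bit:
  assumes "finite D"
  shows "(\<Sum>k\<in>D. of_bool (P k) :: bit) = of_bool (odd (card {k \<in> D. P k}))"
  using assms
proof (induction D rule: finite_induct)
  case (insert x D)
  have "{k \<in> insert x D. P k} = (if P x then insert x {k \<in> D. P k} else {k \<in> D. P k})"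
    by auto
  then show ?case
    using insert by (cases "odd (card {k \<in> D. P k})") simp_all
qed simp

text \<open>Coordinates with respect to a finite basis \<open>B\<close> give a bijection between the
  vectors and the functions from \<open>B\<close> to the scalars.\<close>

lemma (in vectorspace) card_carrier_eq_power_dim:
  assumes "fin_dim"
  shows "card (carrier V) = card (carrier K) ^ dim"
proof -
  obtain B where B: "finite B" "basis B"
    using finite_basis_exists assms by blast
  then have sub: "B \<subseteq> carrier V" by (simp add: basis_def)
  have rep: "\<exists>!a. a \<in> B \<rightarrow>\<^sub>E carrier K \<and> lincomb a B = v" if "v \<in> carrier V" for v
    using basis_criterion[OF B(1) sub] B(2) that by blast
  have "bij_betw (\<lambda>a. lincomb a B) (B \<rightarrow>\<^sub>E carrier K) (carrier V)"
  proof (rule bij_betw_imageI)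
    have closed: "lincomb a B \<in> carrier V" if "a \<in> B \<rightarrow>\<^sub>E carrier K" for a
      using that sub by (intro lincomb_closed) auto
    show "inj_on (\<lambda>a. lincomb a B) (B \<rightarrow>\<^sub>E carrier K)"
      using rep closed by (auto intro!: inj_onI)
    show "(\<lambda>a. lincomb a B) ` (B \<rightarrow>\<^sub>E carrier K) = carrier V"
    proof
      show "(\<lambda>a. lincomb a B) ` (B \<rightarrow>\<^sub>E carrier K) \<subseteq> carrier V"
        using closed by blast
      show "carrier V \<subseteq> (\<lambda>a. lincomb a B) ` (B \<rightarrow>\<^sub>E carrier K)"
        using rep by blast
    qed
  qed
  then have "card (carrier V) = card (carrier K) ^ card B"
    using B(1) by (simp add: bij_betw_same_card[symmetric] card_funcsetE)
  then show ?thesis using dim_basis[OF B] by simp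
qed

text \<open>There are two scalars, so a column space of dimension r has 2^r elements. From here on
  ranks are handled by counting vectors.\<close>

lemma card_bit_col_space:
  fixes M :: "bit mat"
  assumes "M \<in> carrier_mat n nc"
  shows "card {M *\<^sub>v x | x. x \<in> carrier_vec nc} = 2 ^ vec_space.rank n M"
proof -
  interpret vec_space "TYPE(bit)" n .
  have sub: "set (cols M) \<subseteq> carrier_vec n"
    using assms cols_dim by blast
  interpret S: vectorspace "class_ring :: bit ring" "span_vs (set (cols M))"
    using span_is_subspace[OF sub] subspace_is_vs by blast
  have "card (col_space M) = card (carrier (class_ring :: bit ring)) ^ rank M"
    using S.card_carrier_eq_power_dim fin_dim_span_cols[OF assms]
    by (simp add: rank_def col_space_def)
  moreover have "card (carrier (class_ring :: bit ring)) = 2"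
  proof -
    have UNIV: "(UNIV :: bit set) = {0, 1}"
      using bit.exhaust by blast
    show ?thesis by (simp add: class_ring_simps) (simp add: UNIV)
  qed
  moreover have "col_space M = {M *\<^sub>v x | x. x \<in> carrier_vec nc}"
    using assms unfolding col_space_eq[OF assms] by auto
  ultimately show ?thesis by simp
qed

text \<open>
  The column space of the cut matrix; vectors over the two-element field are represented by sets of
  vertices, and their addition by the symmetric difference.
\<close>

definition cut_space :: "'a pair_pre_digraph \<Rightarrow> 'a set \<Rightarrow> 'a set set" where
  "cut_space G A = (\<lambda>D. Odd G D \<inter> A) ` Pow (pverts G - A)"

text \<open>Subsets of \<open>A\<close> and of its complement are identified with their
  characteristic vectors; multiplication by the cut matrix then becomes the map from
  \<open>D\<close> to \<open>Odd G D \<inter> A\<close>.\<close>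

lemma card_cut_space:
  fixes G :: "'a::linorder pair_pre_digraph"
  assumes fin: "finite (pverts G)" and A: "A \<subseteq> pverts G"
  shows "card (cut_space G A) = 2 ^ cutrk G A"
proof -
  define rs cs where "rs = sorted_list_of_set A" and "cs = sorted_list_of_set (pverts G - A)"
  have finA: "finite A" using fin A finite_subset by blast
  have rs: "set rs = A" "distinct rs" and cs: "set cs = pverts G - A" "distinct cs"
    using finA fin by (auto simp: rs_def cs_def)
  have M: "cut_matrix G A =
      mat (length rs) (length cs) (\<lambda>(i, j). of_bool ((rs ! i, cs ! j) \<in> parcs G))" (is "_ = ?M")
    unfolding cut_matrix_def rs_def cs_def Let_def of_bool_def ..
  define \<phi> :: "'a set \<Rightarrow> bit vec" where "\<phi> Y = vec (length rs) (\<lambda>i. of_bool (rs ! i \<in> Y))" for Y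
  have \<phi>_mult: "\<phi> (Odd G D \<inter> A) = ?M *\<^sub>v vec (length cs) (\<lambda>j. of_bool (cs ! j \<in> D))"
    if D: "D \<subseteq> pverts G - A" for D
  proof (rule eq_vecI)
    fix i assume "i < dim_vec (?M *\<^sub>v vec (length cs) (\<lambda>j. of_bool (cs ! j \<in> D)))"
    then have i: "i < length rs" by simp
    then have iA: "rs ! i \<in> A" using rs by auto
    have "(?M *\<^sub>v vec (length cs) (\<lambda>j. of_bool (cs ! j \<in> D))) $ i
        = (\<Sum>j = 0..<length cs. of_bool ((rs ! i, cs ! j) \<in> parcs G \<and> cs ! j \<in> D))"
      using i by (simp add: scalar_prod_def)
    also have "\<dots> = (\<Sum>c\<in>set cs. of_bool ((rs ! i, c) \<in> parcs G \<and> c \<in> D))"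
      unfolding atLeast0LessThan
      by (rule sum.reindex_bij_betw) (use cs(2) in \<open>simp add: bij_betw_nth\<close>)
    also have "\<dots> = of_bool (odd (card {c \<in> set cs. (rs ! i, c) \<in> parcs G \<and> c \<in> D}))"
      by (rule sum_of_bool_bit) simp
    also have "{c \<in> set cs. (rs ! i, c) \<in> parcs G \<and> c \<in> D} = neighborhood G (rs ! i) \<inter> D"
      using D cs by (auto simp: neighborhood_def)
    finally show "\<phi> (Odd G D \<inter> A) $ i = (?M *\<^sub>v vec (length cs) (\<lambda>j. of_bool (cs ! j \<in> D))) $ i"
      using i iA A by (auto simp: \<phi>_def Odd_def)
  qed (simp add: \<phi>_def)
  have "inj_on \<phi> (Pow A)"
  proof (rule inj_onI)
    fix X Y assume XY: "X \<in> Pow A" "Y \<in> Pow A" "\<phi> X = \<phi> Y"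
    have "rs ! i \<in> X \<longleftrightarrow> rs ! i \<in> Y" if "i < length rs" for i
      using arg_cong[OF XY(3), of "\<lambda>v. v $ i"] that
      by (cases "rs ! i \<in> X"; cases "rs ! i \<in> Y") (simp_all add: \<phi>_def)
    then have "a \<in> X \<longleftrightarrow> a \<in> Y" if "a \<in> A" for a
      using that unfolding rs(1)[symmetric] in_set_conv_nth by blast
    then show "X = Y" using XY by blast
  qed
  then have "card (cut_space G A) = card (\<phi> ` cut_space G A)"
    by (intro card_image[symmetric], elim inj_on_subset) (auto simp: cut_space_def)
  also have "\<phi> ` cut_space G A = {?M *\<^sub>v x | x. x \<in> carrier_vec (length cs)}"
  proof (intro equalityI subsetI)
    fix y assume "y \<in> \<phi> ` cut_space G A"
    then obtain D where D: "D \<subseteq> pverts G - A" "y = \<phi> (Odd G D \<inter> A)"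
      by (auto simp: cut_space_def)
    then have "y = ?M *\<^sub>v vec (length cs) (\<lambda>j. of_bool (cs ! j \<in> D))"
      using \<phi>_mult by blast
    then show "y \<in> {?M *\<^sub>v x | x. x \<in> carrier_vec (length cs)}"
      using vec_carrier by blast
  next
    fix y assume "y \<in> {?M *\<^sub>v x | x. x \<in> carrier_vec (length cs)}"
    then obtain x where x: "x \<in> carrier_vec (length cs)" "y = ?M *\<^sub>v x" by blast
    define D where "D = {cs ! j | j. j < length cs \<and> x $ j = 1}"
    have D: "D \<subseteq> pverts G - A" unfolding cs(1)[symmetric] D_def using nth_mem by blast
    have "cs ! j \<in> D \<longleftrightarrow> x $ j = 1" if "j < length cs" for j
      using that cs(2) by (auto simp: D_def nth_eq_iff_index_eq)
    then have "x $ j = of_bool (cs ! j \<in> D)" if "j < length cs" for j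
      using that by (cases "x $ j") auto
    then have "x = vec (length cs) (\<lambda>j. of_bool (cs ! j \<in> D))"
      using x(1) by (intro eq_vecI) auto
    then have "y = \<phi> (Odd G D \<inter> A)" using x(2) \<phi>_mult[OF D] by simp
    then show "y \<in> \<phi> ` cut_space G A" using D by (auto simp: cut_space_def)
  qed
  also have "card \<dots> = 2 ^ cutrk G A"
    using card_bit_col_space[of ?M "length rs" "length cs"] unfolding cutrk_def M by simp
  finally show ?thesis .
qed


text \<open>The cut space lies in \<open>Pow A\<close>, so it is proper exactly when it has fewer
  elements, and both cardinalities are powers of 2.\<close>

lemma cutrk_less_card_iff:
  fixes G :: "'a::linorder pair_pre_digraph"
  assumes "finite (pverts G)" "A \<subseteq> pverts G"
  shows "cutrk G A < card A \<longleftrightarrow> cut_space G A \<noteq> Pow A"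
proof -
  have finA: "finite A" using assms finite_subset by blast
  have sub: "cut_space G A \<subseteq> Pow A" by (auto simp: cut_space_def)
  have "cut_space G A \<noteq> Pow A \<longleftrightarrow> card (cut_space G A) < card (Pow A)"
    using sub finA psubset_card_mono[of "Pow A" "cut_space G A"] by auto
  also have "\<dots> \<longleftrightarrow> cutrk G A < card A"
    using card_cut_space[OF assms] finA by (simp add: card_Pow)
  finally show ?thesis by simp
qed

section \<open>Orthogonality modulo 2\<close>

lemma even_card_sym_diff:
  assumes "finite A" "finite B"
  shows "even (card (A - B \<union> (B - A))) \<longleftrightarrow> (even (card A) \<longleftrightarrow> even (card B))"
proof -
  have "card A = card (A - B) + card (A \<inter> B)" "card B = card (B - A) + card (A \<inter> B)"
    using assms by (metis card_Diff_subset_Int finite_Int le_add_diff_inverse2 card_mono Int_lower1 Int_lower2 Int_commute)+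
  moreover have "card (A - B \<union> (B - A)) = card (A - B) + card (B - A)"
    using assms by (intro card_Un_disjoint) auto
  ultimately show ?thesis by auto
qed

text \<open>In vector terms: a proper subspace over the two-element field has a nonzero orthogonal
  vector. In the induction, if \<open>W\<close> contains all of \<open>Pow A\<close>, then no member
  contains \<open>x\<close>, as otherwise \<open>W\<close> would be everything, and
  \<open>{x}\<close> works. Otherwise \<open>E\<close> comes from the members inside
  \<open>A\<close>, and adding \<open>x\<close> to it repairs the parity if necessary.\<close>

lemma proper_subspace_annihilator:
  assumes "finite A" "W \<subseteq> Pow A" "W \<noteq> Pow A" "{} \<in> W"
    and "\<And>X Y. X \<in> W \<Longrightarrow> Y \<in> W \<Longrightarrow> X - Y \<union> (Y - X) \<in> W"
  shows "\<exists>E\<subseteq>A. E \<noteq> {} \<and> (\<forall>X\<in>W. even (card (X \<inter> E)))"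
  using assms
proof (induction A arbitrary: W rule: finite_induct)
  case empty
  then show ?case by auto
next
  case (insert x A)
  show ?case
  proof (cases "Pow A \<subseteq> W")
    case True
    have "x \<notin> X" if X: "X \<in> W" for X
    proof
      assume "x \<in> X"
      have "Y \<in> W" if Y: "Y \<subseteq> insert x A" for Y
      proof (cases "x \<in> Y")
        case False
        then show ?thesis using Y True by blast
      next
        case x: True
        have "X \<subseteq> insert x A" using X insert.prems(1) by blast
        then have "X - Y \<union> (Y - X) \<subseteq> A" using Y x \<open>x \<in> X\<close> by blast
        then have "X - Y \<union> (Y - X) \<in> W" using True by blast
        \<comment> \<open>Adding \<open>X\<close> a second time gives back \<open>Y\<close>.\<close>
        from insert.prems(4)[OF X this] show ?thesis
          by (rule back_subst[of "\<lambda>Z. Z \<in> W"]) blast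
      qed
      then show False using insert.prems(1,2) by blast
    qed
    then show ?thesis by (intro exI[of _ "{x}"]) auto
  next
    case False
    have "\<exists>E\<subseteq>A. E \<noteq> {} \<and> (\<forall>X\<in>W \<inter> Pow A. even (card (X \<inter> E)))"
      by (rule insert.IH) (use False insert.prems in \<open>auto 0 3\<close>)
    then obtain E where E: "E \<subseteq> A" "E \<noteq> {}"
      and even: "\<And>X. X \<in> W \<Longrightarrow> X \<subseteq> A \<Longrightarrow> even (card (X \<inter> E))"
      by blast
    show ?thesis
    proof (cases "\<forall>X\<in>W. even (card (X \<inter> E))")
      case True
      then show ?thesis using E by blast
    next
      case False
      then obtain Z where Z: "Z \<in> W" "odd (card (Z \<inter> E))" by blast
      have fin: "finite (X \<inter> E)" for X
        using E(1) insert.hyps(1) by (meson finite_Int finite_subset)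
      have "x \<in> Z" using Z even insert.prems(1) by blast
      have "x \<notin> E" using E(1) insert.hyps(2) by blast
      have "even (card (X \<inter> insert x E))" if X: "X \<in> W" for X
      proof (cases "x \<in> X")
        case False
        then show ?thesis using even[OF X] X insert.prems(1) by auto
      next
        case True
        \<comment> \<open>\<open>x\<close> cancels in the sum of \<open>X\<close> and
          \<open>Z\<close>, so this sum meets \<open>E\<close> evenly. Hence \<open>X\<close> meets
          \<open>E\<close> oddly, like \<open>Z\<close>, and \<open>x\<close> supplies the missing
          element.\<close>
        have "X - Z \<union> (Z - X) \<subseteq> A" using True \<open>x \<in> Z\<close> X Z(1) insert.prems(1) by blast
        then have "even (card ((X - Z \<union> (Z - X)) \<inter> E))"
          using even insert.prems(4)[OF X Z(1)] by blast
        also have "(X - Z \<union> (Z - X)) \<inter> E = (X \<inter> E - Z \<inter> E) \<union> (Z \<inter> E - X \<inter> E)" by blast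
        finally have "odd (card (X \<inter> E))"
          using even_card_sym_diff[OF fin fin] Z(2) by blast
        then show ?thesis using True \<open>x \<notin> E\<close> fin by simp
      qed
      then show ?thesis using E(1) by (intro exI[of _ "insert x E"]) auto
    qed
  qed
qed

section \<open>Full cut-rank and local sets\<close>

context pair_graph
begin

lemma finite_neighborhood [simp]: "finite (neighborhood G v)"
  by (simp add: neighborhood_def)

lemma Odd_empty [simp]: "Odd G {} = {}"
  by (simp add: Odd_def)

text \<open>Linearity of \<open>Odd G\<close> over the two-element field.\<close>

lemma Odd_sym_diff: "Odd G (X - Y \<union> (Y - X)) = Odd G X - Odd G Y \<union> (Odd G Y - Odd G X)"
proof -
  have "neighborhood G v \<inter> (X - Y \<union> (Y - X)) = (neighborhood G v \<inter> X - neighborhood G v \<inter> Y)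
      \<union> (neighborhood G v \<inter> Y - neighborhood G v \<inter> X)" for v by blast
  then show ?thesis
    by (auto simp: Odd_def even_card_sym_diff)
qed

text \<open>Both sides count the edges between \<open>D\<close> and \<open>E\<close> modulo 2.\<close>

lemma odd_card_Int_Odd_commute:
  assumes "D \<subseteq> pverts G" "E \<subseteq> pverts G"
  shows "odd (card (D \<inter> Odd G E)) \<longleftrightarrow> odd (card (E \<inter> Odd G D))"
proof -
  have fin: "finite D" "finite E" using assms[THEN finite_subset] by auto
  have count: "(\<Sum>u\<in>X. card (neighborhood G u \<inter> Y)) = (\<Sum>u\<in>X. \<Sum>v\<in>Y. of_bool ((u, v) \<in> parcs G))"
    if "finite Y" "Y \<subseteq> pverts G" for X Y
  proof (rule sum.cong[OF refl])
    fix u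
    have "neighborhood G u \<inter> Y = Y \<inter> {v. (u, v) \<in> parcs G}"
      using that(2) by (auto simp: neighborhood_def)
    then show "card (neighborhood G u \<inter> Y) = (\<Sum>v\<in>Y. of_bool ((u, v) \<in> parcs G))"
      using that(1) by simp
  qed
  have parity: "odd (card (X \<inter> Odd G Y)) \<longleftrightarrow> odd (\<Sum>u\<in>X. card (neighborhood G u \<inter> Y))"
    if "finite X" "X \<subseteq> pverts G" for X Y
  proof -
    have "X \<inter> Odd G Y = {u \<in> X. odd (card (neighborhood G u \<inter> Y))}"
      using that(2) by (auto simp: Odd_def)
    then show ?thesis by (simp only: even_sum_iff[OF that(1)])
  qed
  have sym: "(u, v) \<in> parcs G \<longleftrightarrow> (v, u) \<in> parcs G" for u v
    using arcs_symmetric by blast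
  have "(\<Sum>u\<in>D. \<Sum>v\<in>E. of_bool ((u, v) \<in> parcs G)) = (\<Sum>u\<in>E. \<Sum>v\<in>D. of_bool ((u, v) \<in> parcs G) :: nat)"
    by (subst sum.swap, intro sum.cong refl arg_cong[where f = of_bool] sym)
  then show ?thesis using assms fin by (simp add: parity count)
qed

text \<open>The right-hand side denies that \<open>A\<close> contains a local set. By
  \<open>odd_card_Int_Odd_commute\<close>, a set \<open>E\<close> with
  \<open>E \<union> Odd G E \<subseteq> A\<close> is orthogonal to the whole cut space, which
  excludes \<open>{e}\<close> for \<open>e\<close> in \<open>E\<close>; conversely, an annihilator
  of a proper cut space has its odd neighborhood inside \<open>A\<close>.\<close>

lemma cut_space_eq_Pow_iff:
  assumes A: "A \<subseteq> pverts G"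
  shows "cut_space G A = Pow A \<longleftrightarrow> \<not> (\<exists>E\<subseteq>A. E \<noteq> {} \<and> Odd G E \<subseteq> A)"
proof
  assume full: "cut_space G A = Pow A"
  show "\<not> (\<exists>E\<subseteq>A. E \<noteq> {} \<and> Odd G E \<subseteq> A)"
  proof
    assume "\<exists>E\<subseteq>A. E \<noteq> {} \<and> Odd G E \<subseteq> A"
    then obtain E e where E: "E \<subseteq> A" "Odd G E \<subseteq> A" "e \<in> E" by blast
    then have "{e} \<in> cut_space G A" using full by blast
    then obtain D where D: "D \<subseteq> pverts G - A" "Odd G D \<inter> A = {e}"
      by (auto simp: cut_space_def)
    have "E \<inter> Odd G D = {e}" "D \<inter> Odd G E = {}" using D E by blast+
    moreover have "D \<subseteq> pverts G" "E \<subseteq> pverts G" using D E A by blast+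
    ultimately show False using odd_card_Int_Odd_commute[of D E] by simp
  qed
next
  assume no_local: "\<not> (\<exists>E\<subseteq>A. E \<noteq> {} \<and> Odd G E \<subseteq> A)"
  show "cut_space G A = Pow A"
  proof (rule ccontr)
    assume "cut_space G A \<noteq> Pow A"
    moreover have "{} \<in> cut_space G A" by (auto simp: cut_space_def intro!: image_eqI[of _ _ "{}"])
    moreover have "X - Y \<union> (Y - X) \<in> cut_space G A"
      if XY: "X \<in> cut_space G A" "Y \<in> cut_space G A" for X Y
    proof -
      from XY obtain D D' where D: "D \<subseteq> pverts G - A" "D' \<subseteq> pverts G - A"
        and eq: "X = Odd G D \<inter> A" "Y = Odd G D' \<inter> A" by (auto simp: cut_space_def)
      have "X - Y \<union> (Y - X) = Odd G (D - D' \<union> (D' - D)) \<inter> A"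
        unfolding eq Odd_sym_diff by blast
      then show ?thesis using D unfolding cut_space_def by blast
    qed
    moreover have "finite A" using A by (rule finite_subset) simp
    moreover have "cut_space G A \<subseteq> Pow A" by (auto simp: cut_space_def)
    ultimately have "\<exists>E\<subseteq>A. E \<noteq> {} \<and> (\<forall>X\<in>cut_space G A. even (card (X \<inter> E)))"
      by (intro proper_subspace_annihilator)
    then obtain E where E: "E \<subseteq> A" "E \<noteq> {}"
      and even: "\<And>X. X \<in> cut_space G A \<Longrightarrow> even (card (X \<inter> E))" by blast
    have "v \<notin> Odd G E" if v: "v \<in> pverts G - A" for v
    proof -
      \<comment> \<open>Orthogonality to the column of \<open>v\<close> means
        \<open>v \<notin> Odd G E\<close>.\<close>
      have "Odd G {v} \<inter> A \<in> cut_space G A" using v by (auto simp: cut_space_def)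
      then have "even (card (Odd G {v} \<inter> A \<inter> E))" by (rule even)
      also have "Odd G {v} \<inter> A \<inter> E = E \<inter> Odd G {v}" using E by blast
      finally have "even (card ({v} \<inter> Odd G E))"
        using odd_card_Int_Odd_commute[of "{v}" E] v E A by blast
      then show ?thesis by auto
    qed
    then have "Odd G E \<subseteq> A" by (auto simp: Odd_def)
    then show False using no_local E by blast
  qed
qed

text \<open>A local set inside the smaller set lies inside the larger one. Both greedy passes rest
  on this: earlier decisions remain valid while the set changes.\<close>

lemma cut_space_eq_Pow_subset:
  assumes "cut_space G B = Pow B" "A \<subseteq> B" "B \<subseteq> pverts G"
  shows "cut_space G A = Pow A"
proof -
  have "\<not> (\<exists>E\<subseteq>B. E \<noteq> {} \<and> Odd G E \<subseteq> B)"
    using cut_space_eq_Pow_iff[of B] assms by blast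
  then have "\<not> (\<exists>E\<subseteq>A. E \<noteq> {} \<and> Odd G E \<subseteq> A)" using assms(2) by blast
  then show ?thesis using cut_space_eq_Pow_iff[of A] assms by blast
qed

text \<open>A local set properly inside \<open>R\<close> misses some \<open>c\<close> and so lies in
  \<open>R - {c}\<close>; hence single deletions decide minimality. The local set contained in
  \<open>R\<close> must then be \<open>R\<close> itself.\<close>

lemma minimal_local_setI:
  assumes R: "R \<subseteq> pverts G" and nonfull: "cut_space G R \<noteq> Pow R"
    and full: "\<And>c. c \<in> R \<Longrightarrow> cut_space G (R - {c}) = Pow (R - {c})"
  shows "minimal_local_set G R"
proof -
  have eq: "L = R" if L: "local_set G L" "L \<subseteq> R" for L
  proof (rule ccontr)
    assume "L \<noteq> R"
    then obtain c where c: "c \<in> R" "L \<subseteq> R - {c}" using L(2) by blast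
    obtain D where D: "D \<subseteq> pverts G" "L = D \<union> Odd G D"
      using L(1) unfolding local_set_def by blast
    moreover have "D \<noteq> {}" using L(1) D by (auto simp: local_set_def)
    ultimately have "D \<subseteq> R - {c}" "D \<noteq> {}" "Odd G D \<subseteq> R - {c}" using c by auto
    then show False using cut_space_eq_Pow_iff[of "R - {c}"] full[OF c(1)] R by blast
  qed
  obtain E where E: "E \<subseteq> R" "E \<noteq> {}" "Odd G E \<subseteq> R"
    using cut_space_eq_Pow_iff[OF R] nonfull by blast
  then have "local_set G (E \<union> Odd G E)"
    using R unfolding local_set_def by (intro conjI exI[of _ E]) auto
  moreover have "E \<union> Odd G E \<subseteq> R" using E by blast
  ultimately have "local_set G R" using eq by metis
  then show ?thesis using eq unfolding minimal_local_set_def by blast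
qed

lemma cut_space_insert_neq_Pow:
  assumes a: "a \<in> pverts G" and Q: "Q \<subseteq> pverts G - {a}" and full: "cut_space G Q = Pow Q"
    and maximal: "\<And>c. c \<in> pverts G - Q - {a} \<Longrightarrow> cut_space G (insert c Q) \<noteq> Pow (insert c Q)"
  shows "cut_space G (insert a Q) \<noteq> Pow (insert a Q)"
proof
  assume full': "cut_space G (insert a Q) = Pow (insert a Q)"
  define P where "P = pverts G - insert a Q"
  \<comment> \<open>Full cut-rank allows any trace on \<open>insert a Q\<close> to be prescribed for
    the odd neighborhood of a set outside. The trace \<open>{a}\<close> gives \<open>X\<close>, that
    of \<open>Odd G {a}\<close> gives \<open>Y\<close>.\<close>
  have "{a} \<in> cut_space G (insert a Q)" using full' by blast
  then obtain X where X: "X \<subseteq> P" "Odd G X \<inter> insert a Q = {a}"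
    by (auto simp: cut_space_def P_def)
  have "Odd G {a} \<inter> insert a Q \<in> cut_space G (insert a Q)" using full' by blast
  then obtain Y where Y: "Y \<subseteq> P" "Odd G Y \<inter> insert a Q = Odd G {a} \<inter> insert a Q"
    by (auto simp: cut_space_def P_def)
  \<comment> \<open>Adding \<open>a\<close> to \<open>Y\<close> cancels two equal traces, so
    \<open>Odd G Z\<close> avoids \<open>insert a Q\<close>.\<close>
  define Z where "Z = insert a Y"
  have "a \<notin> Y" using Y by (auto simp: P_def)
  then have "Z = Y - {a} \<union> ({a} - Y)" by (auto simp: Z_def)
  then have Z: "a \<in> Z" "Z \<subseteq> insert a P" "Odd G Z \<inter> insert a Q = {}"
    using Y Odd_sym_diff[of Y "{a}"] by (auto simp: Z_def)
  \<comment> \<open>The two intersections agree inside \<open>P\<close>; outside \<open>P\<close>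
    only \<open>a\<close> occurs, and only in the first.\<close>
  have ZX: "Z \<inter> Odd G X = insert a (X \<inter> Odd G Z)"
  proof -
    have "c \<in> Z \<inter> Odd G X \<longleftrightarrow> c \<in> X \<inter> Odd G Z" if c: "c \<in> P" for c
    proof -
      have cV: "c \<in> pverts G - Q - {a}" using c by (auto simp: P_def)
      have "insert c Q \<subseteq> pverts G" using cV Q by auto
      then obtain E where E: "E \<subseteq> insert c Q" "E \<noteq> {}" "Odd G E \<subseteq> insert c Q"
        using cut_space_eq_Pow_iff[of "insert c Q"] maximal[OF cV] by blast
      have "c \<in> E \<or> c \<in> Odd G E"
        using cut_space_eq_Pow_iff[of Q] full E Q by blast
      \<comment> \<open>\<open>E\<close> and \<open>Odd G E\<close> lie in
        \<open>insert c Q\<close>, which \<open>D\<close> and \<open>Odd G D\<close> meet at most in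
        \<open>c\<close>, so the symmetry reduces to a condition on \<open>c\<close> alone.\<close>
      moreover have commute: "c \<in> E \<and> c \<in> Odd G D \<longleftrightarrow> c \<in> D \<and> c \<in> Odd G E"
        if D: "D \<subseteq> insert a P" "Odd G D \<inter> Q = {}" for D
      proof -
        have "E \<inter> Odd G D \<subseteq> {c}" "D \<inter> Odd G E \<subseteq> {c}" using D E Q unfolding P_def by blast+
        then have "E \<inter> Odd G D = (if c \<in> E \<and> c \<in> Odd G D then {c} else {})"
          "D \<inter> Odd G E = (if c \<in> D \<and> c \<in> Odd G E then {c} else {})" by auto
        moreover have "D \<subseteq> pverts G" "E \<subseteq> pverts G" using D E cV Q a by (auto simp: P_def)
        ultimately show ?thesis using odd_card_Int_Odd_commute[of D E] by (auto split: if_splits)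
      qed
      moreover have "X \<subseteq> insert a P" "Odd G X \<inter> Q = {}" "Odd G Z \<inter> Q = {}"
        using X Z Q by auto
      \<comment> \<open>Read as bits, the pairs (\<open>c \<in> X\<close>,
        \<open>c \<in> Odd G X\<close>) and (\<open>c \<in> Z\<close>,
        \<open>c \<in> Odd G Z\<close>) satisfy the same nonzero linear equation. They are therefore
        dependent, and the two mixed products agree.\<close>
      ultimately show ?thesis using Z(2) by blast
    qed
    then show ?thesis using X Z by auto
  qed
  have "a \<notin> X" using X by (auto simp: P_def)
  have "finite X" using X(1) finite_subset[of X "pverts G"] by (auto simp: P_def)
  then have "card (Z \<inter> Odd G X) = Suc (card (X \<inter> Odd G Z))"
    unfolding ZX using \<open>a \<notin> X\<close> by simp
  moreover have "X \<subseteq> pverts G" "Z \<subseteq> pverts G" using X Z a by (auto simp: P_def)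
  ultimately show False using odd_card_Int_Odd_commute[of X Z] by simp
qed

end


section \<open>Verification of programs with resource bounds\<close>

text \<open>The bound holds at every n, and the base n + 1 is never zero, so that enlarging the
  exponent enlarges the bound.\<close>

definition polynomially_bounded :: "(nat \<Rightarrow> nat) \<Rightarrow> bool" where
  "polynomially_bounded f \<longleftrightarrow> (\<exists>c k. \<forall>n. f n \<le> c * (n + 1) ^ k)"

lemma polynomially_bounded_const [intro]: "polynomially_bounded (\<lambda>n. c)"
  unfolding polynomially_bounded_def by (intro exI[of _ c] exI[of _ 0]) simp

lemma polynomially_bounded_id [intro]: "polynomially_bounded (\<lambda>n. n)"
  unfolding polynomially_bounded_def by (intro exI[of _ 1] exI[of _ 1]) simp

lemma polynomially_bounded_add [intro]:
  assumes "polynomially_bounded f" "polynomially_bounded g"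
  shows "polynomially_bounded (\<lambda>n. f n + g n)"
proof -
  obtain c k c' k' where f: "\<And>n. f n \<le> c * (n + 1) ^ k" and g: "\<And>n. g n \<le> c' * (n + 1) ^ k'"
    using assms unfolding polynomially_bounded_def by blast
  have "f n + g n \<le> (c + c') * (n + 1) ^ (k + k')" for n
  proof -
    have "(n + 1) ^ k \<le> (n + 1) ^ (k + k')" "(n + 1) ^ k' \<le> (n + 1) ^ (k + k')"
      by (simp_all add: power_increasing del: add_Suc_right)
    then have "c * (n + 1) ^ k + c' * (n + 1) ^ k' \<le> c * (n + 1) ^ (k + k') + c' * (n + 1) ^ (k + k')"
      by (intro add_mono mult_le_mono2)
    then show ?thesis using add_mono[OF f g, of n n] by (simp add: distrib_right)
  qed
  then show ?thesis unfolding polynomially_bounded_def by blast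
qed

lemma polynomially_bounded_mult [intro]:
  assumes "polynomially_bounded f" "polynomially_bounded g"
  shows "polynomially_bounded (\<lambda>n. f n * g n)"
proof -
  obtain c k c' k' where f: "\<And>n. f n \<le> c * (n + 1) ^ k" and g: "\<And>n. g n \<le> c' * (n + 1) ^ k'"
    using assms unfolding polynomially_bounded_def by blast
  have "f n * g n \<le> (c * c') * (n + 1) ^ (k + k')" for n
    using mult_le_mono[OF f g, of n n] by (simp only: power_add ac_simps)
  then show ?thesis unfolding polynomially_bounded_def by blast
qed

lemma polynomially_bounded_bigo:
  assumes "polynomially_bounded f"
  obtains k where "(\<lambda>n. real (f n)) \<in> O(\<lambda>n. real n ^ k)"
proof -
  obtain c k where f: "\<And>n. f n \<le> c * (n + 1) ^ k"
    using assms unfolding polynomially_bounded_def by blast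
  \<comment> \<open>For n \<ge> 1 the base n + 1 is at most 2n, which costs a factor 2^k.\<close>
  have "real (f n) \<le> (real c * 2 ^ k) * real n ^ k" if "n \<ge> 1" for n
  proof -
    have "f n \<le> c * (2 * n) ^ k"
      using that by (intro order_trans[OF f] mult_le_mono2 power_mono) auto
    then have "real (f n) \<le> real (c * (2 * n) ^ k)" by (simp only: of_nat_le_iff)
    then show ?thesis by (simp add: power_mult_distrib ac_simps)
  qed
  then have "(\<lambda>n. real (f n)) \<in> O(\<lambda>n. real n ^ k)"
    by (intro bigoI[of _ "real c * 2 ^ k"] eventually_sequentiallyI[of 1]) auto
  then show ?thesis by (rule that)
qed

text \<open>A worst case read off the syntax: \<open>u\<close> bounds one query, \<open>n\<close>
  the iterations of each loop, and a loop pays for one more, failing test. Adding the branches of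
  \<open>If\<close> keeps the bound built from sums and products only.\<close>

primrec time_bound :: "nat \<Rightarrow> nat \<Rightarrow> 'q com \<Rightarrow> nat" where
  "time_bound n u Skip = 1"
| "time_bound n u (Assign x e) = 1 + cost e"
| "time_bound n u (Store a d e f) = 1 + cost d + cost e + cost f"
| "time_bound n u (Seq c c') = time_bound n u c + time_bound n u c'"
| "time_bound n u (If e c c') = 1 + cost e + (time_bound n u c + time_bound n u c')"
| "time_bound n u (While e c) = n * (1 + cost e + time_bound n u c) + (1 + cost e)"
| "time_bound n u (Query i) = u"

primrec query_bound :: "nat \<Rightarrow> 'q com \<Rightarrow> nat" where
  "query_bound n Skip = 0"
| "query_bound n (Assign x e) = 0"
| "query_bound n (Store a d e f) = 0"
| "query_bound n (Seq c c') = query_bound n c + query_bound n c'"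
| "query_bound n (If e c c') = query_bound n c + query_bound n c'"
| "query_bound n (While e c) = n * query_bound n c"
| "query_bound n (Query i) = 1"

lemma polynomially_bounded_time_bound [intro]:
  assumes "polynomially_bounded u"
  shows "polynomially_bounded (\<lambda>n. time_bound n (u n) c)"
  by (induction c)
    (simp_all only: time_bound.simps assms polynomially_bounded_const polynomially_bounded_id
      polynomially_bounded_add polynomially_bounded_mult)

text \<open>
  Total correctness within the resources that the syntax of a program suggests if each of its
  loops makes at most \<open>n\<close> iterations and each query takes at most \<open>u\<close> time units.
\<close>

definition runs ::
  "('q \<Rightarrow> state \<Rightarrow> nat \<Rightarrow> state \<Rightarrow> bool) \<Rightarrow> nat \<Rightarrow> nat \<Rightarrow> 'q com \<Rightarrow> state \<Rightarrow> (state \<Rightarrow> bool) \<Rightarrow> bool"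
where
  "runs ask n u c s P \<longleftrightarrow>
     (\<exists>t q s'. exec ask c s t q s' \<and> t \<le> time_bound n u c \<and> q \<le> query_bound n c \<and> P s')"

section \<open>Proof rules for total correctness within the bounds\<close>

lemma runs_Skip: "P s \<Longrightarrow> runs ask n u Skip s P"
  unfolding runs_def by (intro exI conjI, rule exec.Skip) simp_all

lemma runs_Assign: "P (set_reg x (val s e) s) \<Longrightarrow> runs ask n u (Assign x e) s P"
  unfolding runs_def by (intro exI conjI, rule exec.Assign) simp_all

lemma runs_Store:
  "P (set_arr a (val s d) (val s e) (val s f) s) \<Longrightarrow> runs ask n u (Store a d e f) s P"
  unfolding runs_def by (intro exI conjI, rule exec.Store) simp_all

lemma runs_Query: "ask i s t s' \<Longrightarrow> t \<le> u \<Longrightarrow> P s' \<Longrightarrow> runs ask n u (Query i) s P"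
  unfolding runs_def by (intro exI conjI, rule exec.Query, assumption) simp_all

text \<open>The run of the second program is the postcondition of the first, so that the rules
  compute preconditions backwards through a program.\<close>

lemma runs_Seq:
  assumes "runs ask n u c s (\<lambda>s'. runs ask n u c' s' P)"
  shows "runs ask n u (Seq c c') s P"
proof -
  from assms obtain t q s' t' q' s'' where "exec ask c s t q s'" "exec ask c' s' t' q' s''"
    "t \<le> time_bound n u c" "q \<le> query_bound n c" "t' \<le> time_bound n u c'" "q' \<le> query_bound n c'" "P s''"
    unfolding runs_def by blast
  then show ?thesis unfolding runs_def
    by (intro exI[of _ "t + t'"] exI[of _ "q + q'"] exI[of _ s''] conjI exec.Seq) simp_all
qed

lemma runs_If:
  assumes "val s e \<noteq> 0 \<Longrightarrow> runs ask n u c s P" "val s e = 0 \<Longrightarrow> runs ask n u c' s P"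
  shows "runs ask n u (If e c c') s P"
proof (cases "val s e = 0")
  case True
  then obtain t q s' where "exec ask c' s t q s'"
    "t \<le> time_bound n u c'" "q \<le> query_bound n c'" "P s'"
    using assms(2) unfolding runs_def by blast
  then show ?thesis using True unfolding runs_def
    by (intro exI[of _ "1 + cost e + t"] exI[of _ q] exI[of _ s'] conjI exec.IfFalse) simp_all
next
  case False
  then obtain t q s' where "exec ask c s t q s'"
    "t \<le> time_bound n u c" "q \<le> query_bound n c" "P s'"
    using assms(1) unfolding runs_def by blast
  then show ?thesis using False unfolding runs_def
    by (intro exI[of _ "1 + cost e + t"] exI[of _ q] exI[of _ s'] conjI exec.IfTrue) simp_all
qed

lemma runs_mono:
  assumes "runs ask n u c s P" "\<And>s'. P s' \<Longrightarrow> P' s'"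
  shows "runs ask n u c s P'"
  using assms unfolding runs_def by blast

text \<open>Truncated subtraction makes the test nonzero exactly while register \<open>x\<close> is
  below register 0.\<close>

definition For :: "nat \<Rightarrow> 'q com \<Rightarrow> 'q com" where
  "For x c = Seq (Assign x (Const 0))
     (While (Minus (Reg 0) (Reg x)) (Seq c (Assign x (Plus (Reg x) (Const 1)))))"

text \<open>Register 0 holds the order of the graph, which is the number of iterations.\<close>

lemma runs_For:
  assumes start: "reg s 0 = n" "x \<noteq> 0" "I 0 (set_reg x 0 s)"
    and step: "\<And>k s. k < n \<Longrightarrow> reg s 0 = n \<Longrightarrow> reg s x = k \<Longrightarrow> I k s \<Longrightarrow>
      runs ask n u c s (\<lambda>s'. reg s' 0 = n \<and> reg s' x = k \<and> I (Suc k) (set_reg x (Suc k) s'))"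
    and finish: "\<And>s. reg s 0 = n \<Longrightarrow> I n s \<Longrightarrow> P s"
  shows "runs ask n u (For x c) s P"
proof -
  let ?body = "Seq c (Assign x (Plus (Reg x) (Const 1)))"
  let ?while = "While (Minus (Reg 0) (Reg x)) ?body"
  \<comment> \<open>Induction on the number \<open>m\<close> of iterations left; one evaluation of
    the loop test takes 4 time units.\<close>
  have loop: "\<exists>t q s'. exec ask ?while s t q s' \<and> t \<le> m * (4 + time_bound n u ?body) + 4 \<and>
      q \<le> m * query_bound n ?body \<and> P s'"
    if "reg s 0 = n" "reg s x + m = n" "I (reg s x) s" for m s
    using that
  proof (induction m arbitrary: s)
    case 0
    then have "exec ask ?while s 4 0 s"
      using exec.WhileFalse[of s "Minus (Reg 0) (Reg x)" ask ?body] by (simp add: eval_nat_numeral)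
    then show ?case using 0 finish by fastforce
  next
    case (Suc m)
    have "runs ask n u c s (\<lambda>s'. reg s' 0 = n \<and> reg s' x = reg s x \<and>
        I (Suc (reg s x)) (set_reg x (Suc (reg s x)) s'))"
      using Suc.prems by (intro step) auto
    then have "runs ask n u ?body s
        (\<lambda>s'. reg s' 0 = n \<and> reg s' x = Suc (reg s x) \<and> I (Suc (reg s x)) s')"
      using start(2) by (intro runs_Seq, elim runs_mono, intro runs_Assign) (simp add: set_reg_def)
    then obtain t q s' where t: "exec ask ?body s t q s'" "t \<le> time_bound n u ?body"
      "q \<le> query_bound n ?body" and s': "reg s' 0 = n" "reg s' x = Suc (reg s x)" "I (Suc (reg s x)) s'"
      unfolding runs_def by blast
    obtain t' q' s'' where t': "exec ask ?while s' t' q' s''" "t' \<le> m * (4 + time_bound n u ?body) + 4"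
      "q' \<le> m * query_bound n ?body" "P s''"
      using Suc.IH[of s'] s' Suc.prems by auto
    have "exec ask ?while s (4 + t + t') (q + q') s''"
      using exec.WhileTrue[OF _ t(1) t'(1)] Suc.prems by (simp add: eval_nat_numeral)
    moreover have "4 + t + t' \<le> Suc m * (4 + time_bound n u ?body) + 4"
      using t(2) t'(2) by simp
    moreover have "q + q' \<le> Suc m * query_bound n ?body"
      using t(3) t'(3) by simp
    ultimately show ?case using t'(4) by blast
  qed
  have "runs ask n u ?while (set_reg x 0 s) P"
  proof -
    have "reg (set_reg x 0 s) 0 = n" "reg (set_reg x 0 s) x + n = n"
      "I (reg (set_reg x 0 s) x) (set_reg x 0 s)"
      using start by (simp_all add: set_reg_def)
    moreover have "time_bound n u ?while = n * (4 + time_bound n u ?body) + 4"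
      "query_bound n ?while = n * query_bound n ?body"
      by (simp_all add: eval_nat_numeral)
    ultimately show ?thesis
      using loop[of "set_reg x 0 s" n] unfolding runs_def by metis
  qed
  then show ?thesis unfolding For_def by (intro runs_Seq runs_Assign) simp
qed


section \<open>Gaussian elimination\<close>

text \<open>Over the two-element field linear combinations are sums over subsets, so this is the row
  space of \<open>R\<close>; its cardinality plays the part of the rank.\<close>

definition lin_combs :: "('k \<Rightarrow> 'j \<Rightarrow> bit) \<Rightarrow> 'k set \<Rightarrow> ('j \<Rightarrow> bit) set" where
  "lin_combs R K = (\<lambda>D l. \<Sum>k\<in>D. R k l) ` Pow K"

text \<open>Row \<open>k = i\<close> is treated like the others: with pivot entry 1 it is added to
  itself and vanishes, so the step also removes the pivot row.\<close>

definition eliminate :: "('k \<Rightarrow> 'j \<Rightarrow> bit) \<Rightarrow> 'k \<Rightarrow> 'j \<Rightarrow> 'k \<Rightarrow> 'j \<Rightarrow> bit" where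
  "eliminate R i j = (\<lambda>k l. R k l + R k j * R i l)"

lemma bit_add_self: "x + x = (0 :: bit)"
  by (cases x) simp_all

text \<open>All combinations of the new rows vanish in column \<open>j\<close>. The old row space is
  the union of the new one and its translate by row \<open>i\<close>, whose members have entry 1 in
  column \<open>j\<close>; so the two parts are disjoint and of equal size.\<close>

lemma card_lin_combs_eliminate:
  assumes K: "finite K" "i \<in> K" and pivot: "R i j = 1"
  shows "card (lin_combs R K) = 2 * card (lin_combs (eliminate R i j) K)"
proof -
  define R' where "R' = eliminate R i j"
  define add where "add f = (\<lambda>l. f l + R i l)" for f :: "'b \<Rightarrow> bit"
  have R'i: "R' i l = 0" for l
    using pivot by (simp add: R'_def eliminate_def bit_add_self)
  have R'j: "R' k j = 0" for k
    using pivot by (simp add: R'_def eliminate_def bit_add_self)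
  \<comment> \<open>A row added twice cancels, so the same multiples of row \<open>i\<close> recover
    the old rows.\<close>
  have R: "R k l = R' k l + R k j * R i l" for k l
    unfolding R'_def eliminate_def add.assoc bit_add_self by (rule add_0_right[symmetric])
  have comb: "(\<Sum>k\<in>D. R k l) = (\<Sum>k\<in>D. R' k l) + (\<Sum>k\<in>D. R k j) * R i l" for D l
    by (subst R) (simp only: sum.distrib sum_distrib_right)
  have add_add: "add (add f) = f" for f
    by (simp only: add_def add.assoc bit_add_self add_0_right)
  have sub: "f \<in> lin_combs R' K \<union> add ` lin_combs R' K" if f: "f \<in> lin_combs R K" for f
  proof -
    obtain D where D: "D \<subseteq> K" "f = (\<lambda>l. \<Sum>k\<in>D. R k l)"
      using f by (auto simp: lin_combs_def)
    have R'D: "(\<lambda>l. \<Sum>k\<in>D. R' k l) \<in> lin_combs R' K"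
      using D(1) by (auto simp: lin_combs_def)
    show ?thesis
    proof (cases "\<Sum>k\<in>D. R k j")
      assume "(\<Sum>k\<in>D. R k j) = 0"
      then have "f = (\<lambda>l. \<Sum>k\<in>D. R' k l)"
        unfolding D(2) by (intro ext, subst comb) (simp only: mult_zero_left add_0_right)
      then show ?thesis using R'D by blast
    next
      assume "(\<Sum>k\<in>D. R k j) = 1"
      then have "f = add (\<lambda>l. \<Sum>k\<in>D. R' k l)"
        unfolding D(2) add_def by (intro ext, subst comb) (simp only: mult_1_left)
      then show ?thesis using R'D by blast
    qed
  qed
  have super: "f \<in> lin_combs R K \<and> add f \<in> lin_combs R K" if f: "f \<in> lin_combs R' K" for f
  proof -
    obtain D where D: "D \<subseteq> K" "f = (\<lambda>l. \<Sum>k\<in>D. R' k l)"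
      using f by (auto simp: lin_combs_def)
    \<comment> \<open>Row \<open>i\<close> of \<open>R'\<close> is zero, so \<open>i\<close> may be
      dropped from \<open>D\<close>. Then \<open>g\<close> is \<open>f\<close> or
      \<open>add f\<close>, and including \<open>i\<close> again yields the other one.\<close>
    define g where "g = (\<lambda>l. \<Sum>k\<in>D - {i}. R k l)"
    have finD: "finite D" using D(1) K(1) finite_subset by blast
    have drop_i: "(\<Sum>k\<in>D. R' k l) = (\<Sum>k\<in>D - {i}. R' k l)" for l
      using finD by (intro sum.mono_neutral_right) (auto simp: R'i)
    have g: "g = (\<lambda>l. f l + (\<Sum>k\<in>D - {i}. R k j) * R i l)"
      unfolding g_def D(2) drop_i by (intro ext) (rule comb)
    have g_in: "g \<in> lin_combs R K" using D(1) by (auto simp: lin_combs_def g_def)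
    have "(\<Sum>k\<in>insert i (D - {i}). R k l) = R i l + (\<Sum>k\<in>D - {i}. R k l)" for l
      using finD by (intro sum.insert) auto
    then have "add g = (\<lambda>l. \<Sum>k\<in>insert i (D - {i}). R k l)"
      by (simp only: add_def g_def add.commute)
    moreover have "insert i (D - {i}) \<subseteq> K" using D(1) K(2) by blast
    ultimately have add_g_in: "add g \<in> lin_combs R K" unfolding lin_combs_def by blast
    show ?thesis
    proof (cases "\<Sum>k\<in>D - {i}. R k j")
      assume "(\<Sum>k\<in>D - {i}. R k j) = 0"
      then have "f = g" by (simp only: g mult_zero_left add_0_right)
      then show ?thesis using g_in add_g_in by simp
    next
      assume "(\<Sum>k\<in>D - {i}. R k j) = 1"
      then have "g = add f" by (simp only: g add_def mult_1_left)
      then show ?thesis using g_in add_g_in by (simp add: add_add)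
    qed
  qed
  have "lin_combs R K = lin_combs R' K \<union> add ` lin_combs R' K"
    using sub super by blast
  moreover have "lin_combs R' K \<inter> add ` lin_combs R' K = {}"
  proof -
    have f: "f j = 0" if "f \<in> lin_combs R' K" for f
      using that by (auto simp: lin_combs_def R'j)
    then have "f j = 1" if "f \<in> add ` lin_combs R' K" for f
      using that pivot by (auto simp: add_def)
    with f show ?thesis by fastforce
  qed
  moreover have "card (add ` lin_combs R' K) = card (lin_combs R' K)"
    by (intro card_image inj_onI) (metis add_add)
  moreover have "finite (lin_combs R' K)" using K(1) by (simp add: lin_combs_def)
  ultimately show ?thesis by (simp add: card_Un_disjoint R'_def)
qed

lemma card_lin_combs_zero:
  assumes "\<And>k l. k \<in> K \<Longrightarrow> R k l = 0"
  shows "card (lin_combs R K) = 1"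
proof -
  have "(\<lambda>l. \<Sum>k\<in>D. R k l) = (\<lambda>l. 0)" if "D \<subseteq> K" for D
    using that assms by (intro ext sum.neutral) blast
  then have "lin_combs R K = {\<lambda>l. 0}"
    unfolding lin_combs_def by (auto simp: image_iff intro!: exI[of _ "{}"])
  then show ?thesis by simp
qed

text \<open>The transpose of the cut matrix, padded with zero rows and columns to all vertices, so
  that a program can run over all index pairs.\<close>

definition cut_rows :: "'a pair_pre_digraph \<Rightarrow> 'a set \<Rightarrow> 'a \<Rightarrow> 'a \<Rightarrow> bit" where
  "cut_rows G A k l = of_bool (k \<in> pverts G - A \<and> l \<in> A \<and> (l, k) \<in> parcs G)"

text \<open>Row combinations of the transpose are column combinations of the cut matrix: their
  supports form \<open>cut_space G A\<close>. Vertices of \<open>A\<close> index zero rows, hence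
  \<open>D - A\<close>.\<close>

lemma card_lin_combs_cut_rows:
  fixes G :: "'a::linorder pair_pre_digraph"
  assumes fin: "finite (pverts G)" and A: "A \<subseteq> pverts G"
  shows "card (lin_combs (cut_rows G A) (pverts G)) = 2 ^ cutrk G A"
proof -
  define supp :: "('a \<Rightarrow> bit) \<Rightarrow> 'a set" where "supp f = {l. f l = 1}" for f
  have "inj supp"
  proof (rule injI)
    fix f g assume "supp f = supp g"
    then have "f l = 1 \<longleftrightarrow> g l = 1" for l unfolding supp_def by blast
    then show "f = g" by (metis (full_types) bit.exhaust ext)
  qed
  have supp: "supp (\<lambda>l. \<Sum>k\<in>D. cut_rows G A k l) = Odd G (D - A) \<inter> A" if D: "D \<subseteq> pverts G" for D
  proof -
    have finD: "finite D" using D fin finite_subset by blast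
    have "{k \<in> D. k \<in> pverts G - A \<and> l \<in> A \<and> (l, k) \<in> parcs G} = neighborhood G l \<inter> (D - A)"
      if "l \<in> A" for l
      using that D by (auto simp: neighborhood_def)
    moreover have "{k \<in> D. k \<in> pverts G - A \<and> l \<in> A \<and> (l, k) \<in> parcs G} = {}"
      if "l \<notin> A" for l
      using that by blast
    moreover have "(\<Sum>k\<in>D. cut_rows G A k l) = 1 \<longleftrightarrow>
        odd (card {k \<in> D. k \<in> pverts G - A \<and> l \<in> A \<and> (l, k) \<in> parcs G})" for l
      unfolding cut_rows_def sum_of_bool_bit[OF finD] by simp
    ultimately have "(\<Sum>k\<in>D. cut_rows G A k l) = 1 \<longleftrightarrow> l \<in> Odd G (D - A) \<inter> A" for l
      using A by (cases "l \<in> A") (auto simp: Odd_def)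
    then show ?thesis unfolding supp_def by blast
  qed
  have "supp ` lin_combs (cut_rows G A) (pverts G) = (\<lambda>D. Odd G (D - A) \<inter> A) ` Pow (pverts G)"
    unfolding lin_combs_def image_image by (rule image_cong) (use supp in auto)
  also have "\<dots> = cut_space G A"
  proof -
    have "(\<lambda>D. D - A) ` Pow (pverts G) = Pow (pverts G - A)"
      by (auto simp: image_iff)
    then show ?thesis unfolding cut_space_def by (simp add: image_image flip: \<open>_ = Pow (pverts G - A)\<close>)
  qed
  finally have "card (lin_combs (cut_rows G A) (pverts G)) = card (cut_space G A)"
    using card_image[OF inj_on_subset[OF \<open>inj supp\<close>]] by (metis subset_UNIV)
  then show ?thesis using card_cut_space[OF assms] by simp
qed

text \<open>The scratch registers \<open>X\<close> include the loop counters.\<close>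

lemma runs_fill:
  assumes start: "reg s 0 = n" "0 \<notin> X" "x \<in> X" "y \<in> X" "x \<noteq> y"
    and body: "\<And>i j s'. i < n \<Longrightarrow> j < n \<Longrightarrow> reg s' x = i \<Longrightarrow> reg s' y = j \<Longrightarrow>
      (\<forall>z. z \<notin> X \<longrightarrow> reg s' z = reg s z) \<Longrightarrow> (\<forall>b. b \<noteq> a \<longrightarrow> arr s' b = arr s b) \<Longrightarrow>
      runs ask n u c s' (\<lambda>s''. reg s'' x = i \<and> reg s'' y = j \<and>
        (\<forall>z. z \<notin> X \<longrightarrow> reg s'' z = reg s z) \<and>
        arr s'' = (arr s')(a := (arr s' a)(i := (arr s' a i)(j := f i j))))"
    and finish: "\<And>s'. (\<forall>z. z \<notin> X \<longrightarrow> reg s' z = reg s z) \<Longrightarrow> (\<forall>b. b \<noteq> a \<longrightarrow> arr s' b = arr s b) \<Longrightarrow>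
      (\<forall>i<n. \<forall>j<n. arr s' a i j = f i j) \<Longrightarrow> P s'"
  shows "runs ask n u (For x (For y c)) s P"
proof -
  have xy: "x \<noteq> 0" "y \<noteq> 0" using start by metis+
  define frame where "frame s' \<longleftrightarrow> (\<forall>z. z \<notin> X \<longrightarrow> reg s' z = reg s z) \<and> (\<forall>b. b \<noteq> a \<longrightarrow> arr s' b = arr s b)"
    for s' :: state
  have frame_set_reg: "frame (set_reg z k s') \<longleftrightarrow> frame s'" if "z \<in> X" for z k s'
    using that by (auto simp: frame_def set_reg_def)
  show ?thesis
  proof (rule runs_For[where I = "\<lambda>i s'. frame s' \<and> (\<forall>p<i. \<forall>q<n. arr s' a p q = f p q)"])
    show "frame (set_reg x 0 s) \<and> (\<forall>p<0. \<forall>q<n. arr (set_reg x 0 s) a p q = f p q)"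
      using start(3) by (simp add: frame_set_reg) (simp add: frame_def)
  next
    fix i s1
    assume i: "i < n" "reg s1 0 = n" "reg s1 x = i"
      and I: "frame s1 \<and> (\<forall>p<i. \<forall>q<n. arr s1 a p q = f p q)"
    show "runs ask n u (For y c) s1 (\<lambda>s'. reg s' 0 = n \<and> reg s' x = i \<and>
        frame (set_reg x (Suc i) s') \<and> (\<forall>p<Suc i. \<forall>q<n. arr (set_reg x (Suc i) s') a p q = f p q))"
    proof (rule runs_For[where I = "\<lambda>j s'. reg s' x = i \<and> frame s' \<and>
          (\<forall>p<i. \<forall>q<n. arr s' a p q = f p q) \<and> (\<forall>q<j. arr s' a i q = f i q)"])
      show "reg (set_reg y 0 s1) x = i \<and> frame (set_reg y 0 s1) \<and>
          (\<forall>p<i. \<forall>q<n. arr (set_reg y 0 s1) a p q = f p q) \<and> (\<forall>q<0. arr (set_reg y 0 s1) a i q = f i q)"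
        using I i start(4,5) by (simp add: frame_set_reg) (simp add: set_reg_def)
    next
      fix j s2
      assume j: "j < n" "reg s2 0 = n" "reg s2 y = j"
        and J: "reg s2 x = i \<and> frame s2 \<and>
          (\<forall>p<i. \<forall>q<n. arr s2 a p q = f p q) \<and> (\<forall>q<j. arr s2 a i q = f i q)"
      have "runs ask n u c s2 (\<lambda>s''. reg s'' x = i \<and> reg s'' y = j \<and>
          (\<forall>z. z \<notin> X \<longrightarrow> reg s'' z = reg s z) \<and>
          arr s'' = (arr s2)(a := (arr s2 a)(i := (arr s2 a i)(j := f i j))))"
        using J unfolding frame_def by (intro body i(1) j(1) j(3)) auto
      then show "runs ask n u c s2 (\<lambda>s'. reg s' 0 = n \<and> reg s' y = j \<and>
          reg (set_reg y (Suc j) s') x = i \<and> frame (set_reg y (Suc j) s') \<and>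
          (\<forall>p<i. \<forall>q<n. arr (set_reg y (Suc j) s') a p q = f p q) \<and>
          (\<forall>q<Suc j. arr (set_reg y (Suc j) s') a i q = f i q))"
      proof (rule runs_mono)
        fix s3 :: state
        assume s3: "reg s3 x = i \<and> reg s3 y = j \<and> (\<forall>z. z \<notin> X \<longrightarrow> reg s3 z = reg s z) \<and>
          arr s3 = (arr s2)(a := (arr s2 a)(i := (arr s2 a i)(j := f i j)))"
        then have "frame s3" using J by (simp add: frame_def)
        moreover have "reg s3 0 = n" using s3 start(1,2) by simp
        ultimately show "reg s3 0 = n \<and> reg s3 y = j \<and>
          reg (set_reg y (Suc j) s3) x = i \<and> frame (set_reg y (Suc j) s3) \<and>
          (\<forall>p<i. \<forall>q<n. arr (set_reg y (Suc j) s3) a p q = f p q) \<and>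
          (\<forall>q<Suc j. arr (set_reg y (Suc j) s3) a i q = f i q)"
          using s3 J start(4,5) frame_set_reg[of y "Suc j" s3] by (auto simp: set_reg_def less_Suc_eq)
      qed
    next
      fix s2
      assume "reg s2 0 = n" and J: "reg s2 x = i \<and> frame s2 \<and>
          (\<forall>p<i. \<forall>q<n. arr s2 a p q = f p q) \<and> (\<forall>q<n. arr s2 a i q = f i q)"
      then show "reg s2 0 = n \<and> reg s2 x = i \<and>
        frame (set_reg x (Suc i) s2) \<and> (\<forall>p<Suc i. \<forall>q<n. arr (set_reg x (Suc i) s2) a p q = f p q)"
        using start(3) by (auto simp: frame_set_reg less_Suc_eq) (auto simp: set_reg_def)
    qed (use i xy in auto)
  next
    fix s1
    assume "frame s1 \<and> (\<forall>p<n. \<forall>q<n. arr s1 a p q = f p q)"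
    then show "P s1" by (intro finish) (auto simp: frame_def)
  qed (use start xy in auto)
qed


section \<open>Gaussian elimination as a program\<close>

lemma reg_set_reg [simp]: "reg (set_reg x k s) y = (if y = x then k else reg s y)"
  by (simp add: set_reg_def)

lemma arr_set_reg [simp]: "arr (set_reg x k s) = arr s"
  by (simp add: set_reg_def)

lemma runs_Adj:
  assumes "1 + cost d + cost e \<le> u" "P (set_reg x (of_bool ((val s d, val s e) \<in> parcs G)) s)"
  shows "runs (ask_adj G) n u (Query (Adj x d e)) s P"
  using assms by (intro runs_Query) (auto simp: of_bool_def)

text \<open>The absolute difference: exclusive or on bits, and a test for inequality on arbitrary
  numbers.\<close>

definition xor_exp :: "exp \<Rightarrow> exp \<Rightarrow> exp" where
  "xor_exp d e = Plus (Minus d e) (Minus e d)"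

text \<open>On bits, truncated subtraction forms a conjunction: the stored value is 1 only if the
  vertices are adjacent, that of the column lies in the set and that of the row does not.\<close>

definition load_cut_rows :: "adj_test com" where
  "load_cut_rows = For 1 (For 2 (Seq (Query (Adj 6 (Reg 2) (Reg 1)))
     (Store 1 (Reg 1) (Reg 2)
       (Minus (Plus (Reg 6) (Arr 0 (Const 0) (Reg 2))) (Plus (Const 1) (Arr 0 (Const 0) (Reg 1)))))))"

text \<open>The product of two bits is their sum minus 1, truncated. Array 2 buffers the result
  because the pivot row and column in array 1 are read throughout the first double loop.\<close>

definition eliminate_com :: "adj_test com" where
  "eliminate_com = Seq
     (For 3 (For 4 (Store 2 (Reg 3) (Reg 4)
       (xor_exp (Arr 1 (Reg 3) (Reg 4))
         (Minus (Plus (Arr 1 (Reg 3) (Reg 2)) (Arr 1 (Reg 1) (Reg 4))) (Const 1))))))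
     (For 3 (For 4 (Store 1 (Reg 3) (Reg 4) (Arr 2 (Reg 3) (Reg 4)))))"

definition pivot_step :: "adj_test com" where
  "pivot_step = If (Arr 1 (Reg 1) (Reg 2))
     (Seq (Assign 5 (Plus (Reg 5) (Const 1))) eliminate_com) Skip"

text \<open>Instead of a pivot search with row exchanges, every position is tried as a pivot in
  row-major order.\<close>

definition cutrk_com :: "adj_test com" where
  "cutrk_com = Seq load_cut_rows (Seq (For 1 (For 2 pivot_step)) (Assign 0 (Reg 5)))"

definition stores :: "nat \<Rightarrow> (nat \<Rightarrow> nat \<Rightarrow> bit) \<Rightarrow> state \<Rightarrow> bool" where
  "stores n R s \<longleftrightarrow> (\<forall>k<n. \<forall>l<n. arr s 1 k l = of_bool (R k l = 1))"

lemma runs_load_cut_rows: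
  assumes V: "pverts G = {..<n}" and A: "A \<subseteq> {..<n}" and u: "3 \<le> u"
    and s: "reg s 0 = n" "\<And>j. j < n \<Longrightarrow> arr s 0 0 j = of_bool (j \<in> A)"
    and finish: "\<And>s'. (\<forall>z. z \<notin> {1, 2, 6} \<longrightarrow> reg s' z = reg s z) \<Longrightarrow> stores n (cut_rows G A) s' \<Longrightarrow> P s'"
  shows "runs (ask_adj G) n u load_cut_rows s P"
  unfolding load_cut_rows_def
proof (rule runs_fill[where X = "{1, 2, 6}" and a = 1 and f = "\<lambda>i j. of_bool (cut_rows G A i j = 1)"])
  fix i j and s' :: state
  assume i: "i < n" and j: "j < n" and regs: "reg s' 1 = i" "reg s' 2 = j"
    "\<forall>z. z \<notin> {1, 2, 6} \<longrightarrow> reg s' z = reg s z" and "\<forall>b. b \<noteq> 1 \<longrightarrow> arr s' b = arr s b"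
  then have arr0: "arr s' 0 0 l = of_bool (l \<in> A)" if "l < n" for l
    using s(2) that by simp
  show "runs (ask_adj G) n u (Seq (Query (Adj 6 (Reg 2) (Reg 1)))
       (Store 1 (Reg 1) (Reg 2)
       (Minus (Plus (Reg 6) (Arr 0 (Const 0) (Reg 2))) (Plus (Const 1) (Arr 0 (Const 0) (Reg 1)))))) s'
     (\<lambda>s''. reg s'' 1 = i \<and> reg s'' 2 = j \<and> (\<forall>z. z \<notin> {1, 2, 6} \<longrightarrow> reg s'' z = reg s z) \<and>
        arr s'' = (arr s')(1 := (arr s' 1)(i := (arr s' 1 i)(j := of_bool (cut_rows G A i j = 1)))))"
    using i j regs u V A arr0
    by (intro runs_Seq runs_Adj runs_Store) (auto simp: set_arr_def cut_rows_def)
next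
  fix s' :: state
  assume "\<forall>z. z \<notin> {1, 2, 6} \<longrightarrow> reg s' z = reg s z"
    "\<forall>i<n. \<forall>j<n. arr s' 1 i j = of_bool (cut_rows G A i j = 1)"
  then show "P s'" by (intro finish) (auto simp: stores_def)
qed (use s in auto)

lemma runs_eliminate_com:
  assumes s: "reg s 0 = n" "reg s 1 < n" "reg s 2 < n" "stores n R s"
    and finish: "\<And>s'. (\<forall>z. z \<notin> {3, 4} \<longrightarrow> reg s' z = reg s z) \<Longrightarrow>
      stores n (eliminate R (reg s 1) (reg s 2)) s' \<Longrightarrow> P s'"
  shows "runs ask n u eliminate_com s P"
  unfolding eliminate_com_def
proof (rule runs_Seq, rule runs_fill[where X = "{3, 4}" and a = 2
      and f = "\<lambda>k l. of_bool (eliminate R (reg s 1) (reg s 2) k l = 1)"])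
  fix k l and s' :: state
  assume k: "k < n" and l: "l < n" and regs: "reg s' 3 = k" "reg s' 4 = l"
    "\<forall>z. z \<notin> {3, 4} \<longrightarrow> reg s' z = reg s z" and "\<forall>b. b \<noteq> 2 \<longrightarrow> arr s' b = arr s b"
  then have arr1: "arr s' 1 p q = of_bool (R p q = 1)" if "p < n" "q < n" for p q
    using s(4) that by (simp add: stores_def)
  have "val s' (xor_exp (Arr 1 (Reg 3) (Reg 4))
      (Minus (Plus (Arr 1 (Reg 3) (Reg 2)) (Arr 1 (Reg 1) (Reg 4))) (Const 1)))
      = of_bool (eliminate R (reg s 1) (reg s 2) k l = 1)"
    using k l regs s(2,3) arr1
    by (cases "R k l"; cases "R k (reg s 2)"; cases "R (reg s 1) l") (simp_all add: xor_exp_def eliminate_def)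
  then show "runs ask n u (Store 2 (Reg 3) (Reg 4) (xor_exp (Arr 1 (Reg 3) (Reg 4))
      (Minus (Plus (Arr 1 (Reg 3) (Reg 2)) (Arr 1 (Reg 1) (Reg 4))) (Const 1)))) s'
    (\<lambda>s''. reg s'' 3 = k \<and> reg s'' 4 = l \<and> (\<forall>z. z \<notin> {3, 4} \<longrightarrow> reg s'' z = reg s z) \<and>
      arr s'' = (arr s')(2 := (arr s' 2)(k := (arr s' 2 k)
        (l := of_bool (eliminate R (reg s 1) (reg s 2) k l = 1)))))"
    using regs by (intro runs_Store) (simp add: set_arr_def)
next
  fix s1 :: state
  assume regs1: "\<forall>z. z \<notin> {3, 4} \<longrightarrow> reg s1 z = reg s z"
    and arr2: "\<forall>k<n. \<forall>l<n. arr s1 2 k l = of_bool (eliminate R (reg s 1) (reg s 2) k l = 1)"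
  show "runs ask n u (For 3 (For 4 (Store 1 (Reg 3) (Reg 4) (Arr 2 (Reg 3) (Reg 4))))) s1 P"
  proof (rule runs_fill[where X = "{3, 4}" and a = 1
        and f = "\<lambda>k l. of_bool (eliminate R (reg s 1) (reg s 2) k l = 1)"])
    fix k l and s' :: state
    assume "k < n" "l < n" "reg s' 3 = k" "reg s' 4 = l"
      "\<forall>z. z \<notin> {3, 4} \<longrightarrow> reg s' z = reg s1 z" "\<forall>b. b \<noteq> 1 \<longrightarrow> arr s' b = arr s1 b"
    then show "runs ask n u (Store 1 (Reg 3) (Reg 4) (Arr 2 (Reg 3) (Reg 4))) s'
      (\<lambda>s''. reg s'' 3 = k \<and> reg s'' 4 = l \<and> (\<forall>z. z \<notin> {3, 4} \<longrightarrow> reg s'' z = reg s1 z) \<and>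
        arr s'' = (arr s')(1 := (arr s' 1)(k := (arr s' 1 k)
          (l := of_bool (eliminate R (reg s 1) (reg s 2) k l = 1)))))"
      using arr2 by (intro runs_Store) (simp add: set_arr_def)
  next
    fix s' :: state
    assume "\<forall>z. z \<notin> {3, 4} \<longrightarrow> reg s' z = reg s1 z"
      "\<forall>k<n. \<forall>l<n. arr s' 1 k l = of_bool (eliminate R (reg s 1) (reg s 2) k l = 1)"
    then show "P s'" using regs1 by (intro finish) (auto simp: stores_def)
  qed (use s regs1 in auto)
qed (use s in auto)

text \<open>The pivots found so far are counted in register 5; a pivot row is zeroed by its own elimination step.\<close>

definition elimination_inv :: "nat \<Rightarrow> nat \<Rightarrow> nat \<Rightarrow> nat \<Rightarrow> state \<Rightarrow> bool" where
  "elimination_inv N n i j s \<longleftrightarrow>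
     (\<exists>R. stores n R s \<and> (\<forall>k l. n \<le> l \<longrightarrow> R k l = 0) \<and> 2 ^ reg s 5 * card (lin_combs R {..<n}) = N \<and>
        (\<forall>k<n. \<forall>l<n. k < i \<or> k = i \<and> l < j \<longrightarrow> R k l = 0))"

lemma elimination_inv_set_reg [simp]:
  "x \<noteq> 5 \<Longrightarrow> elimination_inv N n i j (set_reg x v s) = elimination_inv N n i j s"
  by (simp add: elimination_inv_def stores_def set_reg_def)

lemma elimination_inv_Suc: "elimination_inv N n i n s \<Longrightarrow> elimination_inv N n (Suc i) 0 s"
  unfolding elimination_inv_def less_Suc_eq by blast

text \<open>An elimination halves the row space while register 5 grows by one, which preserves the
  product \<open>N\<close>.\<close>

lemma runs_pivot_step:
  assumes s: "reg s 0 = n" "reg s 1 = i" "i < n" "reg s 2 = j" "j < n"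
    and inv: "elimination_inv N n i j s"
  shows "runs ask n u pivot_step s
    (\<lambda>s'. reg s' 0 = n \<and> reg s' 1 = i \<and> reg s' 2 = j \<and> elimination_inv N n i (Suc j) s')"
proof -
  obtain R where R: "stores n R s" "\<And>k l. n \<le> l \<Longrightarrow> R k l = 0"
    "2 ^ reg s 5 * card (lin_combs R {..<n}) = N"
    "\<And>k l. k < n \<Longrightarrow> l < n \<Longrightarrow> k < i \<or> k = i \<and> l < j \<Longrightarrow> R k l = 0"
    using inv unfolding elimination_inv_def by blast
  have pivot: "val s (Arr 1 (Reg 1) (Reg 2)) = of_bool (R i j = 1)"
    using R(1) s by (simp add: stores_def)
  show ?thesis
    unfolding pivot_step_def
  proof (rule runs_If)
    assume "val s (Arr 1 (Reg 1) (Reg 2)) \<noteq> 0"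
    then have Rij: "R i j = 1" using pivot by (simp split: if_splits)
    define s1 where "s1 = set_reg 5 (Suc (reg s 5)) s"
    have s1: "reg s1 0 = n" "reg s1 1 = i" "reg s1 2 = j" "reg s1 5 = Suc (reg s 5)" "stores n R s1"
      using s R(1) by (simp_all add: s1_def set_reg_def stores_def)
    \<comment> \<open>Cleared positions satisfy this criterion: rows above \<open>i\<close> are zero
      also in column \<open>j\<close>, and the pivot row is zero left of \<open>j\<close>.\<close>
    have zero: "eliminate R i j k l = 0" if "R k l = 0" "R k j = 0 \<or> R i l = 0" for k l
      using that by (auto simp: eliminate_def)
    have "runs ask n u eliminate_com s1
      (\<lambda>s'. reg s' 0 = n \<and> reg s' 1 = i \<and> reg s' 2 = j \<and> elimination_inv N n i (Suc j) s')"
    proof (rule runs_eliminate_com[where R = R])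
      fix s' :: state
      assume regs: "\<forall>z. z \<notin> {3, 4} \<longrightarrow> reg s' z = reg s1 z"
        and st: "stores n (eliminate R (reg s1 1) (reg s1 2)) s'"
      have "2 ^ reg s' 5 * card (lin_combs (eliminate R i j) {..<n}) = N"
        using card_lin_combs_eliminate[of "{..<n}" i R j] Rij s(3) R(3) s1(4) regs by simp
      moreover have "eliminate R i j k l = 0" if "n \<le> l" for k l
        using that R(2) by (intro zero) auto
      moreover have "eliminate R i j k l = 0" if kl: "k < n" "l < n" "k < i \<or> k = i \<and> l < Suc j" for k l
      proof (cases "k = i \<and> l = j")
        case True
        then show ?thesis using Rij by (simp add: eliminate_def)
      next
        case False
        then have "k < i \<or> k = i \<and> l < j" using kl(3) by auto
        then show ?thesis using R(4) kl(1,2) s(3,5) by (intro zero) auto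
      qed
      ultimately show "reg s' 0 = n \<and> reg s' 1 = i \<and> reg s' 2 = j \<and> elimination_inv N n i (Suc j) s'"
        using regs st s1 unfolding elimination_inv_def by auto
    qed (use s s1 in auto)
    then show "runs ask n u (Seq (Assign 5 (Plus (Reg 5) (Const 1))) eliminate_com) s
      (\<lambda>s'. reg s' 0 = n \<and> reg s' 1 = i \<and> reg s' 2 = j \<and> elimination_inv N n i (Suc j) s')"
      by (intro runs_Seq runs_Assign) (simp add: s1_def)
  next
    assume "val s (Arr 1 (Reg 1) (Reg 2)) = 0"
    then have "R i j = 0" using pivot by (simp split: if_splits)
    then have "R k l = 0" if "k < n" "l < n" "k < i \<or> k = i \<and> l < Suc j" for k l
      using that R(4) by (auto simp: less_Suc_eq)
    then have "elimination_inv N n i (Suc j) s"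
      unfolding elimination_inv_def using R(1-3) by blast
    then show "runs ask n u Skip s
      (\<lambda>s'. reg s' 0 = n \<and> reg s' 1 = i \<and> reg s' 2 = j \<and> elimination_inv N n i (Suc j) s')"
      using s by (intro runs_Skip) simp
  qed
qed

text \<open>The bound 3 is the duration of an adjacency test between two registers, the only query
  in the program.\<close>

lemma runs_cutrk_com:
  assumes V: "pverts G = {..<n}" and A: "A \<subseteq> {..<n}"
  shows "runs (ask_adj G) n 3 cutrk_com (sub_start n A) (\<lambda>s. reg s 0 = cutrk G A)"
  unfolding cutrk_com_def
proof (rule runs_Seq, rule runs_load_cut_rows[OF V A order_refl])
  fix s :: state
  assume regs: "\<forall>z. z \<notin> {1, 2, 6} \<longrightarrow> reg s z = reg (sub_start n A) z"
    and st: "stores n (cut_rows G A) s"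
  define N :: nat where "N = 2 ^ cutrk G A"
  have inv0: "elimination_inv N n 0 0 s"
    unfolding elimination_inv_def
  proof (intro exI conjI)
    show "stores n (cut_rows G A) s" by (rule st)
    show "\<forall>k l. n \<le> l \<longrightarrow> cut_rows G A k l = 0" using A by (auto simp: cut_rows_def)
    show "2 ^ reg s 5 * card (lin_combs (cut_rows G A) {..<n}) = N"
      using card_lin_combs_cut_rows[of G A] V A regs by (simp add: N_def sub_start_def)
  qed simp
  have reg0: "reg s 0 = n" using regs by (simp add: sub_start_def)
  show "runs (ask_adj G) n 3 (Seq (For 1 (For 2 pivot_step)) (Assign 0 (Reg 5))) s
    (\<lambda>s. reg s 0 = cutrk G A)"
  proof (rule runs_Seq, rule runs_For[where I = "\<lambda>i. elimination_inv N n i 0"])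
    fix i and s1 :: state
    assume i: "i < n" "reg s1 0 = n" "reg s1 1 = i" "elimination_inv N n i 0 s1"
    show "runs (ask_adj G) n 3 (For 2 pivot_step) s1
      (\<lambda>s'. reg s' 0 = n \<and> reg s' 1 = i \<and> elimination_inv N n (Suc i) 0 (set_reg 1 (Suc i) s'))"
    proof (rule runs_For[where I = "\<lambda>j s'. reg s' 1 = i \<and> elimination_inv N n i j s'"])
      fix j and s2 :: state
      assume "j < n" "reg s2 0 = n" "reg s2 2 = j" "reg s2 1 = i \<and> elimination_inv N n i j s2"
      then show "runs (ask_adj G) n 3 pivot_step s2 (\<lambda>s'. reg s' 0 = n \<and> reg s' 2 = j \<and>
          reg (set_reg 2 (Suc j) s') 1 = i \<and> elimination_inv N n i (Suc j) (set_reg 2 (Suc j) s'))"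
        using i(1) by (intro runs_mono[OF runs_pivot_step[of s2 n i j N]]) auto
    qed (use i in \<open>auto simp: elimination_inv_Suc\<close>)
  next
    fix s1 :: state
    assume "elimination_inv N n n 0 s1"
    then obtain R where R: "\<And>k l. n \<le> l \<Longrightarrow> R k l = 0"
      "2 ^ reg s1 5 * card (lin_combs R {..<n}) = N" "\<And>k l. k < n \<Longrightarrow> l < n \<Longrightarrow> R k l = 0"
      unfolding elimination_inv_def by blast
    \<comment> \<open>All rows are cleared, so a single combination is left and register 5 holds the
      exponent of \<open>N\<close>.\<close>
    have "card (lin_combs R {..<n}) = 1"
      using R(1,3) by (intro card_lin_combs_zero) (metis lessThan_iff not_le)
    then have "reg s1 5 = cutrk G A" using R(2) by (simp add: N_def)
    then show "runs (ask_adj G) n 3 (Assign 0 (Reg 5)) s1 (\<lambda>s. reg s 0 = cutrk G A)"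
      by (intro runs_Assign) (simp add: set_reg_def)
  qed (use inv0 reg0 in auto)
qed (use A in \<open>auto simp: sub_start_def\<close>)

section \<open>Greedy search for minimal local sets\<close>

text \<open>Once all vertices are below \<open>k\<close>, this says that \<open>Q\<close> has full
  cut-rank and loses it when any vertex other than \<open>a\<close> is added.\<close>

definition greedy_inv :: "'a::linorder pair_pre_digraph \<Rightarrow> 'a \<Rightarrow> 'a \<Rightarrow> 'a set \<Rightarrow> bool" where
  "greedy_inv G a k Q \<longleftrightarrow> Q \<subseteq> pverts G - {a} \<and> (\<forall>c\<in>Q. c < k) \<and> cut_space G Q = Pow Q \<and>
     (\<forall>c\<in>pverts G. c < k \<longrightarrow> c \<noteq> a \<longrightarrow> c \<notin> Q \<longrightarrow> cut_space G (insert c Q) \<noteq> Pow (insert c Q))"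

text \<open>The condition on \<open>R - {a}\<close> keeps \<open>a\<close> from ever being dropped:
  removing it would leave a set of full cut-rank.\<close>

definition shrink_inv :: "'a::linorder pair_pre_digraph \<Rightarrow> 'a \<Rightarrow> 'a \<Rightarrow> 'a set \<Rightarrow> bool" where
  "shrink_inv G a k R \<longleftrightarrow> R \<subseteq> pverts G \<and> a \<in> R \<and> cut_space G R \<noteq> Pow R \<and>
     cut_space G (R - {a}) = Pow (R - {a}) \<and>
     (\<forall>c\<in>R. c < k \<longrightarrow> cut_space G (R - {c}) = Pow (R - {c}))"

lemma greedy_inv_0: "greedy_inv G a (0::nat) {}"
  by (auto simp: greedy_inv_def cut_space_def)

text \<open>Rejections survive the growth of \<open>Q\<close>: if adding \<open>c\<close> to the
  larger set kept full cut-rank, so would adding it to the smaller one.\<close>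

lemma greedy_inv_Suc:
  fixes G :: "nat pair_pre_digraph"
  assumes G: "pair_graph G" and inv: "greedy_inv G a k Q" and k: "k \<in> pverts G" "k \<noteq> a"
  shows "greedy_inv G a (Suc k)
    (if cut_space G (insert k Q) = Pow (insert k Q) then insert k Q else Q)"
proof (cases "cut_space G (insert k Q) = Pow (insert k Q)")
  case True
  have "cut_space G (insert c (insert k Q)) \<noteq> Pow (insert c (insert k Q))"
    if c: "c \<in> pverts G" "c < k" "c \<noteq> a" "c \<notin> Q" for c
  proof
    assume "cut_space G (insert c (insert k Q)) = Pow (insert c (insert k Q))"
    then have "cut_space G (insert c Q) = Pow (insert c Q)"
      by (rule pair_graph.cut_space_eq_Pow_subset[OF G])
        (use inv c(1) k(1) in \<open>auto simp: greedy_inv_def\<close>)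
    then show False using inv c unfolding greedy_inv_def by blast
  qed
  then show ?thesis
    using True inv k by (auto simp: greedy_inv_def less_Suc_eq)
next
  case False
  then show ?thesis using inv by (auto simp: greedy_inv_def less_Suc_eq)
qed

lemma greedy_inv_Suc_self: "greedy_inv G a (a::nat) Q \<Longrightarrow> greedy_inv G a (Suc a) Q"
  by (auto simp: greedy_inv_def less_Suc_eq)

text \<open>At \<open>k = n\<close> every vertex other than \<open>a\<close> has been considered, so
  \<open>cut_space_insert_neq_Pow\<close> applies and hands a set without full cut-rank to the
  second pass.\<close>

lemma shrink_inv_0:
  fixes G :: "nat pair_pre_digraph"
  assumes G: "pair_graph G" and V: "pverts G = {..<n}" and a: "a < n" and inv: "greedy_inv G a n Q"
  shows "shrink_inv G a 0 (insert a Q)"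
proof -
  have "cut_space G (insert a Q) \<noteq> Pow (insert a Q)"
    by (rule pair_graph.cut_space_insert_neq_Pow[OF G]) (use V a inv in \<open>auto simp: greedy_inv_def\<close>)
  moreover have "insert a Q - {a} = Q" using inv by (auto simp: greedy_inv_def)
  ultimately show ?thesis
    using V a inv by (auto simp: shrink_inv_def greedy_inv_def)
qed

text \<open>A set \<open>R - {c}\<close> of full cut-rank retains it when further vertices go, so a
  vertex once kept need not be tested again.\<close>

lemma shrink_inv_Suc:
  fixes G :: "nat pair_pre_digraph"
  assumes G: "pair_graph G" and inv: "shrink_inv G a k R"
  shows "shrink_inv G a (Suc k)
    (if cut_space G (R - {k}) = Pow (R - {k}) then R else R - {k})"
proof (cases "cut_space G (R - {k}) = Pow (R - {k})")
  case True
  then show ?thesis using inv by (auto simp: shrink_inv_def less_Suc_eq)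
next
  case False
  have "cut_space G (R - {k} - {c}) = Pow (R - {k} - {c})"
    if "cut_space G (R - {c}) = Pow (R - {c})" for c
    using that by (rule pair_graph.cut_space_eq_Pow_subset[OF G]) (use inv in \<open>auto simp: shrink_inv_def\<close>)
  moreover have "k \<noteq> a" using inv False by (auto simp: shrink_inv_def)
  ultimately show ?thesis using inv False by (auto simp: shrink_inv_def less_Suc_eq)
qed

lemma shrink_inv_minimal_local_set:
  assumes "pair_graph G" "pverts G = {..<n}" "shrink_inv G a (n::nat) R"
  shows "minimal_local_set G R"
proof -
  have "R \<subseteq> {..<n}" using assms(2,3) by (simp add: shrink_inv_def)
  then have "c < n" if "c \<in> R" for c using that by blast
  then have "cut_space G (R - {c}) = Pow (R - {c})" if "c \<in> R" for c
    using assms(3) that by (simp add: shrink_inv_def)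
  moreover have "R \<subseteq> pverts G" "cut_space G R \<noteq> Pow R"
    using assms(3) by (simp_all add: shrink_inv_def)
  ultimately show ?thesis by (intro pair_graph.minimal_local_setI[OF assms(1)])
qed

section \<open>The two greedy passes as a program\<close>

lemma reg_set_arr [simp]: "reg (set_arr a i j v s) = reg s"
  by (simp add: set_arr_def)

lemma row_set_set_reg [simp]: "row_set n (set_reg x v s) = row_set n s"
  by (simp add: row_set_def fun_eq_iff)

lemma row_set_set_arr:
  "j < n \<Longrightarrow> row_set n (set_arr a i j v s) b k =
    (if b = a \<and> k = i then if v = 0 then row_set n s a i - {j} else insert j (row_set n s a i)
     else row_set n s b k)"
  by (auto simp: row_set_def set_arr_def)

lemma sub_run_cutrk_com:
  assumes "pverts G = {..<n}" "A \<subseteq> {..<n}"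
  shows "\<exists>t \<le> time_bound n 3 cutrk_com. sub_run cutrk_com G A t (cutrk G A)"
proof -
  have "card (pverts G) = n" using assms(1) by simp
  then show ?thesis
    using runs_cutrk_com[OF assms] unfolding runs_def sub_run_def by metis
qed

lemma runs_Eval:
  assumes V: "pverts G = {..<n}" and u: "1 + cost e + n + time_bound n 3 cutrk_com \<le> u"
    and P: "P (set_reg x (cutrk G (row_set n s a (val s e))) s)"
  shows "runs (ask_sub cutrk_com G) n u (Query (Eval x a e)) s P"
proof -
  obtain t where t: "t \<le> time_bound n 3 cutrk_com"
    "sub_run cutrk_com G (row_set n s a (val s e)) t (cutrk G (row_set n s a (val s e)))"
    using sub_run_cutrk_com[OF V, of "row_set n s a (val s e)"] by (auto simp: row_set_def)
  show ?thesis
  proof (rule runs_Query)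
    show "ask_sub cutrk_com G (Eval x a e) s (1 + cost e + n + t)
        (set_reg x (cutrk G (row_set n s a (val s e))) s)"
      using t(2) V by auto
  qed (use t(1) u P in auto)
qed

text \<open>With \<open>a\<close> in register 1, row \<open>a\<close> of array 0 holds the set and
  register 3 its size. The candidate in register 2 is inserted tentatively and taken out again if
  the cut-rank is below the new size; \<open>a\<close> itself is skipped.\<close>

definition grow_step :: "cutrk_call com" where
  "grow_step = If (xor_exp (Reg 1) (Reg 2))
     (Seq (Store 0 (Reg 1) (Reg 2) (Const 1))
     (Seq (Query (Eval 4 0 (Reg 1)))
       (If (Minus (Plus (Reg 3) (Const 1)) (Reg 4))
         (Store 0 (Reg 1) (Reg 2) (Const 0))
         (Assign 3 (Plus (Reg 3) (Const 1))))))
     Skip"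

text \<open>Register 3 now holds the size of the set minus one. This is the value left by the
  growing pass once \<open>a\<close> has joined, and also the size of each candidate
  \<open>R - {c}\<close>.\<close>

definition shrink_step :: "cutrk_call com" where
  "shrink_step = If (Arr 0 (Reg 1) (Reg 2))
     (Seq (Store 0 (Reg 1) (Reg 2) (Const 0))
     (Seq (Query (Eval 4 0 (Reg 1)))
       (If (Minus (Reg 3) (Reg 4))
         (Assign 3 (Minus (Reg 3) (Const 1)))
         (Store 0 (Reg 1) (Reg 2) (Const 1)))))
     Skip"

text \<open>The set found for vertex \<open>a\<close> stays in row \<open>a\<close>, and register 0
  keeps n, so the final memory already has the form of the output.\<close>

definition MLS_cover_com :: "cutrk_call com" where
  "MLS_cover_com = For 1
     (Seq (Assign 3 (Const 0))
     (Seq (For 2 grow_step)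
     (Seq (Store 0 (Reg 1) (Reg 1) (Const 1))
       (For 2 shrink_step))))"

text \<open>\<open>u\<close> bounds one call of the subroutine: 2 for the instruction with its
  register argument, n for passing the row, the rest for the subroutine itself.\<close>

context
  fixes G :: "nat pair_pre_digraph" and n u :: nat
  assumes G: "pair_graph G" and V: "pverts G = {..<n}"
    and u: "2 + n + time_bound n 3 cutrk_com \<le> u"
begin

lemma cutrk_test: "A \<subseteq> {..<n} \<Longrightarrow> card A - cutrk G A = 0 \<longleftrightarrow> cut_space G A = Pow A"
  using cutrk_less_card_iff[of G A] V by auto

lemma runs_grow_step:
  assumes s: "reg s 0 = n" "reg s 1 = a" "a < n" "reg s 2 = c" "c < n"
    and inv: "greedy_inv G a c (row_set n s 0 a)" "reg s 3 = card (row_set n s 0 a)"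
  shows "runs (ask_sub cutrk_com G) n u grow_step s (\<lambda>s'. reg s' 0 = n \<and> reg s' 1 = a \<and> reg s' 2 = c \<and>
    (\<forall>i. i \<noteq> a \<longrightarrow> row_set n s' 0 i = row_set n s 0 i) \<and>
    greedy_inv G a (Suc c) (row_set n s' 0 a) \<and> reg s' 3 = card (row_set n s' 0 a))"
proof -
  define Q where "Q = row_set n s 0 a"
  \<comment> \<open>Members of \<open>Q\<close> are below \<open>c\<close>, so the tentative
    insertion enlarges the row by exactly one.\<close>
  have Q: "Q \<subseteq> {..<n}" "c \<notin> Q" "finite Q"
    using inv(1) unfolding Q_def[symmetric] greedy_inv_def V by (auto intro: finite_subset)
  show ?thesis
    unfolding grow_step_def
  proof (rule runs_If)
    assume "val s (xor_exp (Reg 1) (Reg 2)) \<noteq> 0"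
    then have "c \<noteq> a" using s by (auto simp: xor_exp_def)
    have step: "greedy_inv G a (Suc c) (if cut_space G (insert c Q) = Pow (insert c Q) then insert c Q else Q)"
      unfolding Q_def by (rule greedy_inv_Suc[OF G inv(1)]) (use \<open>c \<noteq> a\<close> s(5) V in auto)
    have test: "Suc (card Q) - cutrk G (insert c Q) = 0 \<longleftrightarrow> cut_space G (insert c Q) = Pow (insert c Q)"
      using cutrk_test[of "insert c Q"] Q s(5) by simp
    show "runs (ask_sub cutrk_com G) n u (Seq (Store 0 (Reg 1) (Reg 2) (Const 1))
     (Seq (Query (Eval 4 0 (Reg 1)))
       (If (Minus (Plus (Reg 3) (Const 1)) (Reg 4))
         (Store 0 (Reg 1) (Reg 2) (Const 0))
         (Assign 3 (Plus (Reg 3) (Const 1)))))) s (\<lambda>s'. reg s' 0 = n \<and> reg s' 1 = a \<and> reg s' 2 = c \<and>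
      (\<forall>i. i \<noteq> a \<longrightarrow> row_set n s' 0 i = row_set n s 0 i) \<and>
      greedy_inv G a (Suc c) (row_set n s' 0 a) \<and> reg s' 3 = card (row_set n s' 0 a))"
      using s inv(2) Q step test u unfolding Q_def[symmetric]
      by (intro runs_Seq runs_Store runs_Eval[OF V] runs_If runs_Assign)
        (auto simp: row_set_set_arr Q_def[symmetric])
  next
    assume "val s (xor_exp (Reg 1) (Reg 2)) = 0"
    then have "c = a" using s by (simp add: xor_exp_def)
    then show "runs (ask_sub cutrk_com G) n u Skip s (\<lambda>s'. reg s' 0 = n \<and> reg s' 1 = a \<and> reg s' 2 = c \<and>
      (\<forall>i. i \<noteq> a \<longrightarrow> row_set n s' 0 i = row_set n s 0 i) \<and>
      greedy_inv G a (Suc c) (row_set n s' 0 a) \<and> reg s' 3 = card (row_set n s' 0 a))"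
      using s inv greedy_inv_Suc_self by (intro runs_Skip) auto
  qed
qed

lemma runs_shrink_step:
  assumes s: "reg s 0 = n" "reg s 1 = a" "a < n" "reg s 2 = c" "c < n"
    and inv: "shrink_inv G a c (row_set n s 0 a)" "Suc (reg s 3) = card (row_set n s 0 a)"
  shows "runs (ask_sub cutrk_com G) n u shrink_step s (\<lambda>s'. reg s' 0 = n \<and> reg s' 1 = a \<and> reg s' 2 = c \<and>
    (\<forall>i. i \<noteq> a \<longrightarrow> row_set n s' 0 i = row_set n s 0 i) \<and>
    shrink_inv G a (Suc c) (row_set n s' 0 a) \<and> Suc (reg s' 3) = card (row_set n s' 0 a))"
proof -
  define R where "R = row_set n s 0 a"
  have R: "R \<subseteq> {..<n}" "finite R" "a \<in> R"
    using inv(1) unfolding R_def[symmetric] shrink_inv_def V by (auto intro: finite_subset)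
  have step: "shrink_inv G a (Suc c) (if cut_space G (R - {c}) = Pow (R - {c}) then R else R - {c})"
    unfolding R_def by (rule shrink_inv_Suc[OF G inv(1)])
  show ?thesis
    unfolding shrink_step_def
  proof (rule runs_If)
    assume "val s (Arr 0 (Reg 1) (Reg 2)) \<noteq> 0"
    then have c: "c \<in> R" using s by (simp add: R_def row_set_def)
    have card: "card (R - {c}) = reg s 3" using c R(2) inv(2) by (simp add: R_def[symmetric])
    have test: "reg s 3 - cutrk G (R - {c}) = 0 \<longleftrightarrow> cut_space G (R - {c}) = Pow (R - {c})"
      using cutrk_test[of "R - {c}"] R unfolding card by auto
    \<comment> \<open>A set without full cut-rank is nonempty, so truncation does not affect the
      decrement of register 3.\<close>
    have pos: "reg s 3 \<noteq> 0" if "cut_space G (R - {c}) \<noteq> Pow (R - {c})"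
      using test that by auto
    show "runs (ask_sub cutrk_com G) n u (Seq (Store 0 (Reg 1) (Reg 2) (Const 0))
     (Seq (Query (Eval 4 0 (Reg 1)))
       (If (Minus (Reg 3) (Reg 4))
         (Assign 3 (Minus (Reg 3) (Const 1)))
         (Store 0 (Reg 1) (Reg 2) (Const 1))))) s (\<lambda>s'. reg s' 0 = n \<and> reg s' 1 = a \<and> reg s' 2 = c \<and>
      (\<forall>i. i \<noteq> a \<longrightarrow> row_set n s' 0 i = row_set n s 0 i) \<and>
      shrink_inv G a (Suc c) (row_set n s' 0 a) \<and> Suc (reg s' 3) = card (row_set n s' 0 a))"
      using s inv(2) R c card step test pos u
      by (intro runs_Seq runs_Store runs_Eval[OF V] runs_If runs_Assign)
        (auto simp: row_set_set_arr R_def[symmetric] insert_absorb)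
  next
    assume "val s (Arr 0 (Reg 1) (Reg 2)) = 0"
    then have "c \<notin> R" using s by (simp add: R_def row_set_def)
    \<comment> \<open>For an absent vertex both outcomes in \<open>step\<close> are
      \<open>R\<close>.\<close>
    then have "R - {c} = R" by blast
    then have "shrink_inv G a (Suc c) R" using step by (simp split: if_splits)
    then show "runs (ask_sub cutrk_com G) n u Skip s (\<lambda>s'. reg s' 0 = n \<and> reg s' 1 = a \<and> reg s' 2 = c \<and>
      (\<forall>i. i \<noteq> a \<longrightarrow> row_set n s' 0 i = row_set n s 0 i) \<and>
      shrink_inv G a (Suc c) (row_set n s' 0 a) \<and> Suc (reg s' 3) = card (row_set n s' 0 a))"
      using s inv(2) by (intro runs_Skip) (simp add: R_def)
  qed
qed

lemma runs_MLS_cover_com: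
  "runs (ask_sub cutrk_com G) n u MLS_cover_com (main_start n)
    (\<lambda>s. MLS_cover G (output_family n s))"
  unfolding MLS_cover_com_def
\<comment> \<open>Rows from \<open>k\<close> on are empty, so each growing pass starts from the
  empty set.\<close>
proof (rule runs_For[where I = "\<lambda>k s.
      (\<forall>i<k. minimal_local_set G (row_set n s 0 i) \<and> i \<in> row_set n s 0 i) \<and> (\<forall>i\<ge>k. row_set n s 0 i = {})"])
  fix a and s :: state
  assume a: "a < n" "reg s 0 = n" "reg s 1 = a"
    and I: "(\<forall>i<a. minimal_local_set G (row_set n s 0 i) \<and> i \<in> row_set n s 0 i) \<and>
      (\<forall>i\<ge>a. row_set n s 0 i = {})"
  define same where "same s' \<longleftrightarrow> (\<forall>i. i \<noteq> a \<longrightarrow> row_set n s' 0 i = row_set n s 0 i)" for s'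
  let ?post = "\<lambda>s'. reg s' 0 = n \<and> reg s' 1 = a \<and>
      (\<forall>i<Suc a. minimal_local_set G (row_set n (set_reg 1 (Suc a) s') 0 i) \<and>
        i \<in> row_set n (set_reg 1 (Suc a) s') 0 i) \<and>
      (\<forall>i\<ge>Suc a. row_set n (set_reg 1 (Suc a) s') 0 i = {})"
  show "runs (ask_sub cutrk_com G) n u (Seq (Assign 3 (Const 0)) (Seq (For 2 grow_step)
     (Seq (Store 0 (Reg 1) (Reg 1) (Const 1)) (For 2 shrink_step)))) s ?post"
  proof (rule runs_Seq, rule runs_Assign, rule runs_Seq,
      rule runs_For[where I = "\<lambda>c s'. reg s' 1 = a \<and> same s' \<and>
        greedy_inv G a c (row_set n s' 0 a) \<and> reg s' 3 = card (row_set n s' 0 a)"])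
    fix c and s1 :: state
    assume c: "c < n" "reg s1 0 = n" "reg s1 2 = c"
      and J: "reg s1 1 = a \<and> same s1 \<and>
        greedy_inv G a c (row_set n s1 0 a) \<and> reg s1 3 = card (row_set n s1 0 a)"
    show "runs (ask_sub cutrk_com G) n u grow_step s1 (\<lambda>s'. reg s' 0 = n \<and> reg s' 2 = c \<and>
        reg (set_reg 2 (Suc c) s') 1 = a \<and> same (set_reg 2 (Suc c) s') \<and>
        greedy_inv G a (Suc c) (row_set n (set_reg 2 (Suc c) s') 0 a) \<and>
        reg (set_reg 2 (Suc c) s') 3 = card (row_set n (set_reg 2 (Suc c) s') 0 a))"
      using a(1) c J by (intro runs_mono[OF runs_grow_step[of s1 a c]]) (simp_all add: same_def)
  next
    fix s1 :: state
    assume s1: "reg s1 0 = n"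
      and J: "reg s1 1 = a \<and> same s1 \<and>
        greedy_inv G a n (row_set n s1 0 a) \<and> reg s1 3 = card (row_set n s1 0 a)"
    define s2 where "s2 = set_arr 0 a a 1 s1"
    have row: "row_set n s2 0 a = insert a (row_set n s1 0 a)"
      using a(1) by (simp add: s2_def row_set_set_arr)
    have "a \<notin> row_set n s1 0 a" "finite (row_set n s1 0 a)"
      using J by (auto simp: greedy_inv_def row_set_def)
    then have card: "card (row_set n s2 0 a) = Suc (reg s2 3)"
      using J by (simp add: row) (simp add: s2_def)
    have "runs (ask_sub cutrk_com G) n u (For 2 shrink_step) s2 ?post"
    proof (rule runs_For[where I = "\<lambda>c s'. reg s' 1 = a \<and> same s' \<and>
          shrink_inv G a c (row_set n s' 0 a) \<and> Suc (reg s' 3) = card (row_set n s' 0 a)"])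
      have "same s2" using J a(1) by (simp add: s2_def same_def row_set_set_arr)
      then show "reg (set_reg 2 0 s2) 1 = a \<and> same (set_reg 2 0 s2) \<and>
          shrink_inv G a 0 (row_set n (set_reg 2 0 s2) 0 a) \<and>
          Suc (reg (set_reg 2 0 s2) 3) = card (row_set n (set_reg 2 0 s2) 0 a)"
        using J card shrink_inv_0[OF G V a(1), of "row_set n s1 0 a"]
        by (simp add: row same_def) (simp add: s2_def)
    next
      fix c and s3 :: state
      assume c: "c < n" "reg s3 0 = n" "reg s3 2 = c"
        and K: "reg s3 1 = a \<and> same s3 \<and>
          shrink_inv G a c (row_set n s3 0 a) \<and> Suc (reg s3 3) = card (row_set n s3 0 a)"
      show "runs (ask_sub cutrk_com G) n u shrink_step s3 (\<lambda>s'. reg s' 0 = n \<and> reg s' 2 = c \<and>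
          reg (set_reg 2 (Suc c) s') 1 = a \<and> same (set_reg 2 (Suc c) s') \<and>
          shrink_inv G a (Suc c) (row_set n (set_reg 2 (Suc c) s') 0 a) \<and>
          Suc (reg (set_reg 2 (Suc c) s') 3) = card (row_set n (set_reg 2 (Suc c) s') 0 a))"
        using a(1) c K by (intro runs_mono[OF runs_shrink_step[of s3 a c]]) (simp_all add: same_def)
    next
      fix s3 :: state
      assume s3: "reg s3 0 = n"
        and K: "reg s3 1 = a \<and> same s3 \<and>
          shrink_inv G a n (row_set n s3 0 a) \<and> Suc (reg s3 3) = card (row_set n s3 0 a)"
      have "minimal_local_set G (row_set n s3 0 a)" "a \<in> row_set n s3 0 a"
        using shrink_inv_minimal_local_set[OF G V] K by (auto simp: shrink_inv_def)
      then show "?post s3" using s3 K I by (auto simp: same_def less_Suc_eq)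
    qed (use s1 in \<open>simp_all add: s2_def\<close>)
    then show "runs (ask_sub cutrk_com G) n u
        (Seq (Store 0 (Reg 1) (Reg 1) (Const 1)) (For 2 shrink_step)) s1 ?post"
      using J by (intro runs_Seq runs_Store) (simp add: s2_def)
  qed (use a I greedy_inv_0 in \<open>auto simp: same_def\<close>)
next
  fix s :: state
  assume "reg s 0 = n" and "(\<forall>i<n. minimal_local_set G (row_set n s 0 i) \<and> i \<in> row_set n s 0 i) \<and>
      (\<forall>i\<ge>n. row_set n s 0 i = {})"
  then show "MLS_cover G (output_family n s)"
    using V by (auto simp: MLS_cover_def output_family_def)
qed (simp_all add: main_start_def row_set_def)

end

text \<open>For each of the n vertices there are two inner loops of n rounds with one query per
  round; this lies within the required n^4.\<close>

lemma query_bound_MLS_cover_com: "query_bound n MLS_cover_com = 2 * n ^ 2"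
  by (simp add: MLS_cover_com_def For_def grow_step_def shrink_step_def algebra_simps power2_eq_square)

theorem mainTheorem2:
  shows "\<exists>(main :: cutrk_call com) (sub :: adj_test com) (T :: nat \<Rightarrow> nat) (Q :: nat \<Rightarrow> nat) (k :: nat).
           (\<lambda>n. real (T n)) \<in> O(\<lambda>n. real n ^ k) \<and>
           (\<lambda>n. real (Q n)) \<in> O(\<lambda>n. real n ^ 4) \<and>
           (\<forall>(n :: nat) (G :: nat pair_pre_digraph).
              pair_graph G \<and> pverts G = {..<n} \<longrightarrow>
              computes_cutrk sub G \<and>
              (\<exists>t q \<L>. algorithm_run main sub G t q \<L> \<and> MLS_cover G \<L> \<and> t \<le> T n \<and> q \<le> Q n))"
proof -
  \<comment> \<open>The time allowed for one subroutine call is itself polynomial in n, and it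
    enters the bound of the main program as the duration of a query.\<close>
  define u where "u n = 2 + n + time_bound n 3 cutrk_com" for n
  define T where "T n = time_bound n (u n) MLS_cover_com" for n
  define Q where "Q n = query_bound n MLS_cover_com" for n
  have "polynomially_bounded u" unfolding u_def by (intro polynomially_bounded_add polynomially_bounded_const
      polynomially_bounded_id polynomially_bounded_time_bound)
  then have "polynomially_bounded T" unfolding T_def by (rule polynomially_bounded_time_bound)
  then obtain k where T: "(\<lambda>n. real (T n)) \<in> O(\<lambda>n. real n ^ k)"
    by (rule polynomially_bounded_bigo)
  have "2 * real n ^ 2 \<le> 2 * real n ^ 4" if "n \<ge> 1" for n
    using that by (intro mult_left_mono power_increasing) auto
  then have Q: "(\<lambda>n. real (Q n)) \<in> O(\<lambda>n. real n ^ 4)"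
    unfolding Q_def query_bound_MLS_cover_com
    by (intro bigoI[of _ 2] eventually_sequentiallyI[of 1]) auto
  have "computes_cutrk cutrk_com G \<and> (\<exists>t q \<L>. algorithm_run MLS_cover_com cutrk_com G t q \<L> \<and>
      MLS_cover G \<L> \<and> t \<le> T n \<and> q \<le> Q n)"
    if G: "pair_graph G" "pverts G = {..<n}" for n and G :: "nat pair_pre_digraph"
  proof
    show "computes_cutrk cutrk_com G"
      unfolding computes_cutrk_def G(2) using sub_run_cutrk_com[OF G(2)] by blast
    have "runs (ask_sub cutrk_com G) n (u n) MLS_cover_com (main_start n)
        (\<lambda>s. MLS_cover G (output_family n s))"
      using G by (intro runs_MLS_cover_com) (simp_all add: u_def)
    then show "\<exists>t q \<L>. algorithm_run MLS_cover_com cutrk_com G t q \<L> \<and> MLS_cover G \<L> \<and> t \<le> T n \<and> q \<le> Q n"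
      unfolding runs_def algorithm_run_def T_def Q_def G(2) by auto
  qed
  with T Q show ?thesis by blast
qed

end
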